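(* Let $\mu$ be a regular isotropic log-concave target on $\mathbb R^n$ with moment potential $\psi$, let $U$ have law $e^{-\psi(u)}du$, and put $Y=\nabla\psi(U)\sim\mu$ and $H=\nabla^2\psi(U)$. Let $\mathsf S_n$, $\Gamma_{\rm tr}$, $\Gamma_{\rm quad}$, $\mathsf T$, $\mathsf U$, $\mathsf D$, $I_{\mathsf S_n}$ and $\preceq$ be as defined in the context. (1) Suppose that, for some $C_q,C_{\rm en}\ge0$, one has $$\operatorname{Var}(Y^{\mathsf T}AY)\le C_q\operatorname{Tr}(A^2),\qquad \mathbb E\operatorname{Tr}(AHAH)\le C_{\rm en}\operatorname{Tr}(A^2)$$ for every $A\in\mathsf S_n$. Then $$0\preceq\Gamma_{\rm tr}\preceq\Bigl(\frac{C_q}{4}+C_{\rm en}\Bigr)I_{\mathsf S_n}.$$ More precisely, the following identity holds, in which each of the three terms on the right-hand side is positive-semidefinite: $$\Bigl(\frac{C_q}{4}+C_{\rm en}\Bigr)I_{\mathsf S_n}-\Gamma_{\rm tr}=\frac14\bigl(C_qI_{\mathsf S_n}-\Gamma_{\rm quad}\bigr)+\bigl(C_{\rm en}I_{\mathsf S_n}-\mathsf U\bigr)+\frac34\mathsf D.$$ (2) Assume that the following two estimates hold: for every isotropic log-concave random vector $W\in\mathbb R^n$ and every $A\in\mathsf S_n$, $\operatorname{Var}(W^{\mathsf T}AW)\le8\operatorname{Tr}(A^2)$; and for every regular isotropic log-concave target on $\mathbb R^n$, with moment-map Hessian $H'$, and every $A\in\mathsf S_n$, $\mathbb E\operatorname{Tr}(AH'AH')\le2\operatorname{Tr}(A^2)$.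 Then the hypotheses of (1) hold with $C_q=8$ and $C_{\rm en}=2$; hence $$4I_{\mathsf S_n}-\Gamma_{\rm tr}=\frac14\bigl(8I_{\mathsf S_n}-\Gamma_{\rm quad}\bigr)+\bigl(2I_{\mathsf S_n}-\mathsf U\bigr)+\frac34\mathsf D\succeq0,$$ and, for every deterministic symmetric $A\in\mathsf S_n$, $$\operatorname{Var}\bigl(\operatorname{Tr}(AH)\bigr)\le4\operatorname{Tr}(A^2).$$ In particular, $\operatorname{Var}(\operatorname{Tr}H)\le4n$.
   Context: A probability measure on $\mathbb R^n$ is log-concave if it has a density of the form $e^{-V}$ on a convex support, where $V$ is convex in the extended sense. A random vector $W\in\mathbb R^n$ is isotropic if $\mathbb E W=0$ and $\mathbb E(WW^{\mathsf T})=I_n$. Regular isotropic log-concave target, moment potential, moment-map Hessian: a regular isotropic log-concave target on $\mathbb R^n$ is an isotropic probability measure $d\mu(y)=e^{-V(y)}\mathbf 1_K(y)\,dy$, where $K\subset\mathbb R^n$ is bounded, open and convex and $V$ is smooth and convex on a neighborhood of $\overline K$. By the moment-measure theorem there is a smooth strictly convex $\psi:\mathbb R^n\to\mathbb R$ (the moment potential), unique up to translation, with $\int e^{-\psi}=1$, such that if $U$ has law $d\nu(u)=e^{-\psi(u)}du$ then $\nabla\psi(U)\sim\mu$; moreover $\nabla\psi:\mathbb R^n\to K$ is a diffeomorphism. The moment-map Hessian is the random matrix $\nabla^2\psi(U)$. Bilinear forms: $\mathsf S_n$ is the space of real symmetric $n\times n$ matrices with inner product $\langle A,B\rangle_{\mathrm{HS}}=\operatorname{Tr}(AB)$.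 For $A,B\in\mathsf S_n$, $\Gamma_{\rm tr}(A,B)=\operatorname{Cov}(\operatorname{Tr}(AH),\operatorname{Tr}(BH))$, $\Gamma_{\rm quad}(A,B)=\operatorname{Cov}(Y^{\mathsf T}AY,Y^{\mathsf T}BY)$, $\mathsf T(A,B)=\mathbb E(AY)^{\mathsf T}H(BY)$, $\mathsf U(A,B)=\mathbb E\operatorname{Tr}(AHBH)$, $\mathsf D=4\mathsf T-\Gamma_{\rm quad}$, $I_{\mathsf S_n}(A,B)=\operatorname{Tr}(AB)$. For symmetric bilinear forms on $\mathsf S_n$, $\mathsf A\preceq\mathsf B$ means $(\mathsf B-\mathsf A)(A,A)\ge0$ for every $A\in\mathsf S_n$. *)

theory Defs
  imports "HOL-Probability.Probability"
begin

section \<open>Differential notions\<close>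

fun Ck_on :: "nat \<Rightarrow> ('a::euclidean_space \<Rightarrow> real) \<Rightarrow> 'a set \<Rightarrow> bool" where
  "Ck_on 0 f S \<longleftrightarrow> continuous_on S f"
| "Ck_on (Suc k) f S \<longleftrightarrow>
     (\<forall>x\<in>S. f differentiable (at x)) \<and>
     (\<forall>v. Ck_on k (\<lambda>x. frechet_derivative f (at x) v) S)"

text \<open>Only used for open \<open>S\<close>.\<close>

definition smooth_on :: "'a::euclidean_space set \<Rightarrow> ('a \<Rightarrow> real) \<Rightarrow> bool" where
  "smooth_on S f \<longleftrightarrow> (\<forall>k. Ck_on k f S)"

definition strictly_convex :: "('a::real_vector \<Rightarrow> real) \<Rightarrow> bool" where
  "strictly_convex f \<longleftrightarrow>
     (\<forall>x y t. x \<noteq> y \<longrightarrow> 0 < t \<longrightarrow> t < 1 \<longrightarrow>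
        f ((1 - t) *\<^sub>R x + t *\<^sub>R y) < (1 - t) * f x + t * f y)"

definition grad :: "(real^'n \<Rightarrow> real) \<Rightarrow> real^'n \<Rightarrow> real^'n" where
  "grad f x = (\<chi> i. frechet_derivative f (at x) (axis i 1))"

definition hessian :: "(real^'n \<Rightarrow> real) \<Rightarrow> real^'n \<Rightarrow> real^'n^'n" where
  "hessian f x = jacobian (grad f) (at x)"

section \<open>Log-concave measures and moment potentials\<close>

text \<open>
  The second equation forces the second moments to be finite, since a non-integrable function has
  Bochner integral \<open>0\<close>; for a probability measure the mean is then well defined too.
\<close>

definition isotropic :: "(real^'n) measure \<Rightarrow> bool" where
  "isotropic M \<longleftrightarrow>
     (\<integral>x. x \<partial>M) = 0 \<and> (\<integral>x. (\<chi> i j. x $ i * x $ j) \<partial>M) = mat 1"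

text \<open>
  An extended-valued convex \<open>V\<close> is represented by its effective domain \<open>K\<close> and its finite values
  there. A convex set need not be Borel, so measurability of the density is a separate condition;
  it can always be achieved by changing the density on the (null) boundary of \<open>K\<close>.
\<close>

definition log_concave :: "(real^'n) measure \<Rightarrow> bool" where
  "log_concave M \<longleftrightarrow> prob_space M \<and>
     (\<exists>K V. convex_on K V \<and>
        (\<lambda>x. exp (- V x) * indicator K x) \<in> borel_measurable borel \<and>
        M = density lborel (\<lambda>x. ennreal (exp (- V x) * indicator K x)))"

text \<open>
  The neighbourhood \<open>N\<close> of \<open>closure K\<close> is convex because \<^const>\<open>convex_on\<close> includes convexity of the
  domain. This loses nothing: \<open>closure K\<close> is compact and convex, so every neighbourhood of it
  contains a convex open one.
\<close>

definition regular_isotropic_log_concave_target :: "(real^'n) measure \<Rightarrow> bool" where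
  "regular_isotropic_log_concave_target \<mu> \<longleftrightarrow> prob_space \<mu> \<and> isotropic \<mu> \<and>
     (\<exists>K V N. bounded K \<and> open K \<and> convex K \<and>
        open N \<and> closure K \<subseteq> N \<and> smooth_on N V \<and> convex_on N V \<and>
        \<mu> = density lborel (\<lambda>y. ennreal (exp (- V y) * indicator K y)))"

definition moment_law :: "(real^'n \<Rightarrow> real) \<Rightarrow> (real^'n) measure" where
  "moment_law \<psi> = density lborel (\<lambda>u. ennreal (exp (- \<psi> u)))"

text \<open>
  That \<open>grad \<psi>\<close> is a diffeomorphism onto the open convex set carrying \<open>\<mu>\<close> is a consequence of these
  conditions when \<open>\<mu>\<close> is a regular target, and is therefore not imposed.
\<close>

definition moment_potential :: "(real^'n) measure \<Rightarrow> (real^'n \<Rightarrow> real) \<Rightarrow> bool" where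
  "moment_potential \<mu> \<psi> \<longleftrightarrow>
     smooth_on UNIV \<psi> \<and> strictly_convex \<psi> \<and>
     (\<integral>u. exp (- \<psi> u) \<partial>lborel) = 1 \<and>
     distr (moment_law \<psi>) borel (grad \<psi>) = \<mu>"

section \<open>Bilinear forms on symmetric matrices\<close>

definition Sym :: "(real^'n^'n) set" where
  "Sym = {A. transpose A = A}"

definition covariance :: "'w measure \<Rightarrow> ('w \<Rightarrow> real) \<Rightarrow> ('w \<Rightarrow> real) \<Rightarrow> real" where
  "covariance P X Z = (\<integral>\<omega>. (X \<omega> - (\<integral>\<omega>. X \<omega> \<partial>P)) * (Z \<omega> - (\<integral>\<omega>. Z \<omega> \<partial>P)) \<partial>P)"

type_synonym 'n form = "real^'n^'n \<Rightarrow> real^'n^'n \<Rightarrow> real"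

definition Gamma_tr :: "'w measure \<Rightarrow> ('w \<Rightarrow> real^'n^'n) \<Rightarrow> ('n::finite) form" where
  "Gamma_tr P H A B = covariance P (\<lambda>\<omega>. trace (A ** H \<omega>)) (\<lambda>\<omega>. trace (B ** H \<omega>))"

definition Gamma_quad :: "'w measure \<Rightarrow> ('w \<Rightarrow> real^'n) \<Rightarrow> ('n::finite) form" where
  "Gamma_quad P Y A B = covariance P (\<lambda>\<omega>. Y \<omega> \<bullet> (A *v Y \<omega>)) (\<lambda>\<omega>. Y \<omega> \<bullet> (B *v Y \<omega>))"

definition T_form :: "'w measure \<Rightarrow> ('w \<Rightarrow> real^'n) \<Rightarrow> ('w \<Rightarrow> real^'n^'n) \<Rightarrow> ('n::finite) form" where
  "T_form P Y H A B = (\<integral>\<omega>. (A *v Y \<omega>) \<bullet> (H \<omega> *v (B *v Y \<omega>)) \<partial>P)"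

definition U_form :: "'w measure \<Rightarrow> ('w \<Rightarrow> real^'n^'n) \<Rightarrow> ('n::finite) form" where
  "U_form P H A B = (\<integral>\<omega>. trace (A ** H \<omega> ** B ** H \<omega>) \<partial>P)"

definition D_form :: "'w measure \<Rightarrow> ('w \<Rightarrow> real^'n) \<Rightarrow> ('w \<Rightarrow> real^'n^'n) \<Rightarrow> ('n::finite) form" where
  "D_form P Y H A B = 4 * T_form P Y H A B - Gamma_quad P Y A B"

definition I_form :: "('n::finite) form" where
  "I_form A B = trace (A ** B)"

definition form_le :: "('n::finite) form \<Rightarrow> 'n form \<Rightarrow> bool"  (infix \<open>\<preceq>\<^sub>S\<close> 50) where
  "F \<preceq>\<^sub>S G \<longleftrightarrow> (\<forall>A\<in>Sym. 0 \<le> G A A - F A A)"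

text \<open>
  All expectations entering the forms exist, so that none of the Bochner integrals above takes its
  default value \<open>0\<close>.
\<close>

definition forms_well_defined ::
  "'w measure \<Rightarrow> ('w \<Rightarrow> real^'n) \<Rightarrow> ('w \<Rightarrow> real^'n^'n) \<Rightarrow> bool" where
  "forms_well_defined P Y H \<longleftrightarrow>
     Y \<in> borel_measurable P \<and> H \<in> borel_measurable P \<and>
     (\<forall>A\<in>Sym. integrable P (\<lambda>\<omega>. (trace (A ** H \<omega>))\<^sup>2) \<and>
               integrable P (\<lambda>\<omega>. (Y \<omega> \<bullet> (A *v Y \<omega>))\<^sup>2)) \<and>
     (\<forall>A\<in>Sym. \<forall>B\<in>Sym.
        integrable P (\<lambda>\<omega>. (A *v Y \<omega>) \<bullet> (H \<omega> *v (B *v Y \<omega>))) \<and>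
        integrable P (\<lambda>\<omega>. trace (A ** H \<omega> ** B ** H \<omega>)))"

section \<open>The two estimates\<close>

definition quadratic_variance_bound ::
  "'w measure \<Rightarrow> ('w \<Rightarrow> real^'n) \<Rightarrow> real \<Rightarrow> bool" where
  "quadratic_variance_bound P Y C \<longleftrightarrow>
     (\<forall>A\<in>Sym. prob_space.variance P (\<lambda>\<omega>. Y \<omega> \<bullet> (A *v Y \<omega>)) \<le> C * trace (A ** A))"

text \<open>
  For a positive-semidefinite \<open>H\<close> the integrand is nonnegative, and its expectation is an element
  of \<open>[0, \<infinity>]\<close>. Bounding it by a real number includes finiteness, hence the integrability clause.
\<close>

definition energy_bound :: "'w measure \<Rightarrow> ('w \<Rightarrow> real^'n^'n) \<Rightarrow> real \<Rightarrow> bool" where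
  "energy_bound P H C \<longleftrightarrow>
     (\<forall>A\<in>Sym. integrable P (\<lambda>\<omega>. trace (A ** H \<omega> ** A ** H \<omega>)) \<and>
               (\<integral>\<omega>. trace (A ** H \<omega> ** A ** H \<omega>) \<partial>P) \<le> C * trace (A ** A))"

end

theory Submission
  imports Defs
begin

text \<open>
  Under \<open>\<nu> = e\<^sup>-\<^sup>\<psi> du\<close> one has \<open>\<integral> (div Z - \<nabla>\<psi> \<bullet> Z) d\<nu> = 0\<close>. For the field
  \<open>Z = Tr(BH) AY + (Y \<bullet> AY) BY - BHAY\<close> the third derivatives of \<open>\<psi>\<close> cancel, and what remains is
  \<open>\<Gamma>\<^sub>t\<^sub>r = \<Gamma>\<^sub>q\<^sub>u\<^sub>a\<^sub>d + U - 3T\<close>, which is the claimed identity. Its only nontrivial positivity is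
  \<open>D \<succeq> 0\<close>, the Brascamp--Lieb inequality for the function \<open>Y \<bullet> AY\<close> of \<open>U\<close>. The latter follows
  by integrating out one coordinate at a time over a large box: an infinitesimal form of Prekopa's
  theorem on marginals reduces each step to a one-dimensional inequality, and it needs neither
  invertibility of the Hessian nor a solution of the elliptic equation.
\<close>

section \<open>Calculus of k times continuously differentiable functions\<close>

text \<open>Integrability shapes the argument. Bounded support of \<open>\<mu>\<close> bounds the
  gradient Y almost surely; the Hessian H is controlled only in mean square, by the energy bound at
  the identity matrix; no bound on third derivatives is available. Integration by parts is therefore
  applied only to fields that are integrable and whose weighted divergence is free of third
  derivatives as a whole. This dictates Z: the first summand produces Tr(AH) Tr(BH), the last
  removes its third derivatives and leaves the energy, and the middle one removes the mixed term (Y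
  \<bullet> AY) Tr(BH). The induction over coordinates takes place in a cube because there every
  continuous function is integrable; integrability over the whole space enters only when the cube
  grows, for the three integrals in the final inequality.\<close>

abbreviation pd :: "'a::euclidean_space \<Rightarrow> ('a \<Rightarrow> real) \<Rightarrow> 'a \<Rightarrow> real" where
  "pd v f \<equiv> (\<lambda>x. frechet_derivative f (at x) v)"

abbreviation Ck :: "nat \<Rightarrow> ('a::euclidean_space \<Rightarrow> real) \<Rightarrow> bool" where
  "Ck k f \<equiv> Ck_on k f UNIV"

lemma has_derivative_pd:
  "f differentiable (at x) \<Longrightarrow> (f has_derivative (\<lambda>v. pd v f x)) (at x)"
  by (simp add: frechet_derivative_works)

lemma pd_eqI: "(f has_derivative f') (at x) \<Longrightarrow> pd v f x = f' v"
  using frechet_derivative_at by metis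

lemma Ck_Suc_has_derivative: "Ck (Suc k) f \<Longrightarrow> (f has_derivative (\<lambda>v. pd v f x)) (at x)"
  by (simp add: has_derivative_pd)

lemma Ck_Suc_pd: "Ck (Suc k) f \<Longrightarrow> Ck k (pd v f)"
  by simp

text \<open>Uniqueness of the derivative identifies any candidate \<open>f'\<close> with the one
  selected by \<open>frechet_derivative\<close>. Membership in the class can thus be read off an
  explicit formula, and the closure rules below follow by induction on \<open>k\<close>.\<close>

lemma Ck_SucI:
  assumes "\<And>x. (f has_derivative (\<lambda>v. f' v x)) (at x)" "\<And>v. Ck k (f' v)"
  shows "Ck (Suc k) f"
proof -
  have "pd v f = f' v" for v
    using pd_eqI[OF assms(1)] by auto
  then show ?thesis
    using assms by (auto simp: differentiable_def)
qed

lemma Ck_pred: "Ck (Suc k) f \<Longrightarrow> Ck k f"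
proof (induction k arbitrary: f)
  case 0
  then show ?case
    by (auto intro!: continuous_at_imp_continuous_on differentiable_imp_continuous_within)
next
  case (Suc k)
  then show ?case by (metis Ck_on.simps(2))
qed

lemma Ck_mono: "Ck k f \<Longrightarrow> j \<le> k \<Longrightarrow> Ck j f"
  by (induction k) (auto simp: le_Suc_eq simp del: Ck_on.simps intro: Ck_pred)

lemma Ck_continuous: "Ck k f \<Longrightarrow> continuous_on A f"
  using Ck_mono[of k f 0] continuous_on_subset by auto

lemma Ck_measurable: "Ck k f \<Longrightarrow> f \<in> borel_measurable borel"
  by (intro borel_measurable_continuous_onI Ck_continuous)

lemma pd_add:
  "f differentiable (at x) \<Longrightarrow> g differentiable (at x) \<Longrightarrow> pd v (\<lambda>x. f x + g x) x = pd v f x + pd v g x"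
  by (rule pd_eqI) (intro derivative_intros has_derivative_pd)

lemma pd_diff:
  "f differentiable (at x) \<Longrightarrow> g differentiable (at x) \<Longrightarrow> pd v (\<lambda>x. f x - g x) x = pd v f x - pd v g x"
  by (rule pd_eqI) (intro derivative_intros has_derivative_pd)

lemma pd_mult:
  "f differentiable (at x) \<Longrightarrow> g differentiable (at x) \<Longrightarrow>
    pd v (\<lambda>x. f x * g x) x = f x * pd v g x + pd v f x * g x"
  by (rule pd_eqI[where f' = "\<lambda>v. f x * pd v g x + pd v f x * g x"])
     (intro derivative_intros has_derivative_pd)

lemma pd_cmult: "f differentiable (at x) \<Longrightarrow> pd v (\<lambda>x. c * f x) x = c * pd v f x"
  by (rule pd_eqI[where f' = "\<lambda>v. c * pd v f x"]) (intro derivative_intros has_derivative_pd)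

lemma pd_sum:
  "(\<And>i. i \<in> I \<Longrightarrow> f i differentiable (at x)) \<Longrightarrow>
    pd v (\<lambda>x. \<Sum>i\<in>I. f i x) x = (\<Sum>i\<in>I. pd v (f i) x)"
  by (rule pd_eqI[where f' = "\<lambda>v. \<Sum>i\<in>I. pd v (f i) x"])
     (intro derivative_intros has_derivative_pd, auto)

lemma pd_exp_minus:
  "f differentiable (at x) \<Longrightarrow> pd v (\<lambda>x. exp (- f x)) x = - (exp (- f x) * pd v f x)"
  by (rule pd_eqI[where f' = "\<lambda>v. - (exp (- f x) * pd v f x)"])
     (auto intro!: derivative_eq_intros has_derivative_pd)

lemma Ck_Suc_linear:
  assumes "Ck (Suc k) f"
  shows "pd (v + w) f x = pd v f x + pd w f x" "pd (c *\<^sub>R v) f x = c * pd v f x"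
proof -
  have "linear (\<lambda>v. pd v f x)"
    using Ck_Suc_has_derivative[OF assms] has_derivative_linear by blast
  then show "pd (v + w) f x = pd v f x + pd w f x" "pd (c *\<^sub>R v) f x = c * pd v f x"
    by (simp_all add: linear_add linear_scale)
qed

lemma Ck_const: "Ck k (\<lambda>x. c)"
proof (induction k arbitrary: c)
  case (Suc k)
  show ?case by (rule Ck_SucI[where f' = "\<lambda>v x. 0"]) (auto intro: Suc)
qed simp

lemma Ck_add: "Ck k f \<Longrightarrow> Ck k g \<Longrightarrow> Ck k (\<lambda>x. f x + g x)"
proof (induction k arbitrary: f g)
  case (Suc k)
  show ?case
    by (rule Ck_SucI[where f' = "\<lambda>v x. pd v f x + pd v g x"])
       (use Suc in \<open>auto intro!: derivative_intros simp del: Ck_on.simps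
          intro: Ck_Suc_pd Ck_Suc_has_derivative\<close>)
qed (auto intro: continuous_intros)

lemma Ck_mult: "Ck k f \<Longrightarrow> Ck k g \<Longrightarrow> Ck k (\<lambda>x. f x * g x)"
proof (induction k arbitrary: f g)
  case (Suc k)
  show ?case
    by (rule Ck_SucI[where f' = "\<lambda>v x. f x * pd v g x + pd v f x * g x"])
       (use Suc in \<open>auto intro!: derivative_intros Ck_add Suc.IH simp del: Ck_on.simps
          intro: Ck_Suc_pd Ck_Suc_has_derivative Ck_pred\<close>)
qed (auto intro: continuous_intros)

lemma Ck_uminus: "Ck k f \<Longrightarrow> Ck k (\<lambda>x. - f x)"
  using Ck_mult[OF Ck_const[of k "-1"], of f] by simp

lemma Ck_diff: "Ck k f \<Longrightarrow> Ck k g \<Longrightarrow> Ck k (\<lambda>x. f x - g x)"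
  using Ck_add[OF _ Ck_uminus, of k f g] by simp

lemma Ck_sum: "(\<And>i. i \<in> I \<Longrightarrow> Ck k (f i)) \<Longrightarrow> Ck k (\<lambda>x. \<Sum>i\<in>I. f i x)"
  by (induction I rule: infinite_finite_induct) (auto intro: Ck_const Ck_add simp del: Ck_on.simps)

lemma Ck_exp: "Ck k f \<Longrightarrow> Ck k (\<lambda>x. exp (f x))"
proof (induction k arbitrary: f)
  case (Suc k)
  show ?case
    by (rule Ck_SucI[where f' = "\<lambda>v x. exp (f x) * pd v f x"])
       (use Suc.prems in \<open>auto intro!: derivative_eq_intros Ck_mult Suc.IH simp del: Ck_on.simps
          intro: Ck_Suc_pd Ck_Suc_has_derivative Ck_pred\<close>)
qed (auto intro: continuous_intros)

lemmas Ck_intros = Ck_const Ck_add Ck_mult Ck_uminus Ck_diff Ck_sum Ck_exp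

section \<open>Differentiation under the integral sign and symmetry of second derivatives\<close>

lemma C1_pd_continuous:
  fixes f :: "'a::euclidean_space \<Rightarrow> real"
  assumes "Ck (Suc k) f"
  shows "continuous_on UNIV (\<lambda>x. Blinfun (\<lambda>v. pd v f x))"
    and "blinfun_apply (Blinfun (\<lambda>v. pd v f x)) = (\<lambda>v. pd v f x)"
proof -
  have bl: "bounded_linear (\<lambda>v. pd v f x)" for x
    using Ck_Suc_has_derivative[OF assms] has_derivative_bounded_linear by blast
  then show *: "blinfun_apply (Blinfun (\<lambda>v. pd v f x)) = (\<lambda>v. pd v f x)" for x
    by (rule bounded_linear_Blinfun_apply)
  show "continuous_on UNIV (\<lambda>x. Blinfun (\<lambda>v. pd v f x))"
    by (rule continuous_on_blinfun_componentwise)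
       (unfold *, rule Ck_continuous[OF Ck_Suc_pd[OF assms]])
qed

text \<open>The Leibniz rule asks for a derivative that is continuous as an operator-valued map,
  hence the passage through \<open>Blinfun\<close>. The linear map \<open>L\<close> is left general:
  it is the identity in \<open>pd_commute\<close> and removes the \<open>e\<close> component for
  marginals.\<close>

lemma line_integral_has_derivative:
  fixes f :: "'a::euclidean_space \<Rightarrow> real" and L :: "'a \<Rightarrow> 'a"
  assumes f: "Ck (Suc k) f" and L: "bounded_linear L"
  shows "((\<lambda>x. integral {a..b} (\<lambda>t. f (L x + t *\<^sub>R e))) has_derivative
           (\<lambda>v. integral {a..b} (\<lambda>t. pd (L v) f (L x + t *\<^sub>R e)))) (at x)"
proof -
  let ?D = "\<lambda>x. Blinfun (\<lambda>v. pd v f x)"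
  have [continuous_intros]: "continuous_on A L" for A
    using L by (simp add: linear_continuous_on)
  let ?B = "\<lambda>x t. blinfun_compose (?D (L x + t *\<^sub>R e)) (Blinfun L)"
  have cont: "continuous_on (UNIV \<times> cbox a b) (\<lambda>(x, t). ?B x t)"
    unfolding split_beta
    by (intro continuous_intros continuous_on_compose2[OF C1_pd_continuous(1)[OF f]])
       (auto intro!: continuous_on_compose2[OF \<open>\<And>A. continuous_on A L\<close>] continuous_intros)
  have der: "((\<lambda>x. f (L x + t *\<^sub>R e)) has_derivative blinfun_apply (?B x t)) (at x within UNIV)" for x t
  proof -
    have "((\<lambda>x. L x + t *\<^sub>R e) has_derivative L) (at x)"
      by (auto intro!: derivative_eq_intros bounded_linear_imp_has_derivative[OF L])
    then have "((\<lambda>x. f (L x + t *\<^sub>R e)) has_derivative (\<lambda>v. pd (L v) f (L x + t *\<^sub>R e))) (at x)"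
      by (rule has_derivative_compose[OF _ Ck_Suc_has_derivative[OF f]])
    then show ?thesis
      by (simp add: C1_pd_continuous(2)[OF f] bounded_linear_Blinfun_apply[OF L] o_def
          blinfun_compose.rep_eq)
  qed
  have int: "(\<lambda>t. f (L x + t *\<^sub>R e)) integrable_on cbox a b" for x
    by (intro integrable_continuous continuous_on_compose2[OF Ck_continuous[OF f, of UNIV]] continuous_intros)
       auto
  have "((\<lambda>x. integral (cbox a b) (\<lambda>t. f (L x + t *\<^sub>R e))) has_derivative
     blinfun_apply (integral (cbox a b) (?B x))) (at x within UNIV)"
    by (rule leibniz_rule[OF der int cont]) auto
  moreover have "blinfun_apply (integral (cbox a b) (?B x)) =
      (\<lambda>v. integral {a..b} (\<lambda>t. pd (L v) f (L x + t *\<^sub>R e)))"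
  proof
    fix v
    have "continuous_on (cbox a b) (\<lambda>t. case (x, t) of (x, t) \<Rightarrow> ?B x t)"
      by (rule continuous_on_compose2[OF cont continuous_on_Pair[OF continuous_on_const continuous_on_id]])
         auto
    then have "?B x integrable_on cbox a b"
      by (intro integrable_continuous) simp
    then have "integral (cbox a b) (\<lambda>t. blinfun_apply (?B x t) v) =
        blinfun_apply (integral (cbox a b) (?B x)) v"
      using integral_linear[of "?B x" "cbox a b" "\<lambda>B. blinfun_apply B v"]
      by (auto simp: o_def bounded_linear_intros)
    then show "blinfun_apply (integral (cbox a b) (?B x)) v =
      integral {a..b} (\<lambda>t. pd (L v) f (L x + t *\<^sub>R e))"
      by (simp add: C1_pd_continuous(2)[OF f] bounded_linear_Blinfun_apply[OF L])
  qed
  ultimately show ?thesis by simp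
qed

lemma integral_eq_imp_eq_at_0:
  fixes f g :: "real \<Rightarrow> real"
  assumes "continuous_on UNIV f" "continuous_on UNIV g"
    and "\<And>s. 0 \<le> s \<Longrightarrow> s \<le> 1 \<Longrightarrow> integral {0..s} f = integral {0..s} g"
  shows "f 0 = g 0"
proof -
  have *: "((\<lambda>s. integral {0..s} h) has_real_derivative h 0) (at 0 within {0..1})"
    if "continuous_on UNIV h" for h :: "real \<Rightarrow> real"
    using integral_has_real_derivative[of 0 1 h 0] that continuous_on_subset by fastforce
  have "((\<lambda>s. integral {0..s} f) has_real_derivative g 0) (at 0 within {0..1})"
    using assms(3) by (intro has_field_derivative_transform_within[OF *[OF assms(2)], of 1]) auto
  with *[OF assms(1)] show ?thesis
    by (rule has_field_derivative_unique) (simp add: trivial_limit_within islimpt_Icc)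
qed

lemma line_has_real_derivative:
  fixes F :: "'a::euclidean_space \<Rightarrow> real"
  assumes "Ck (Suc k) F"
  shows "((\<lambda>t. F (y + t *\<^sub>R e)) has_real_derivative pd e F (y + t *\<^sub>R e)) (at t)"
proof -
  have "((\<lambda>t. y + t *\<^sub>R e) has_derivative (\<lambda>s. s *\<^sub>R e)) (at t)"
    by (auto intro!: derivative_eq_intros)
  then have "((\<lambda>t. F (y + t *\<^sub>R e)) has_derivative (\<lambda>s. pd (s *\<^sub>R e) F (y + t *\<^sub>R e))) (at t)"
    by (rule has_derivative_compose[OF _ Ck_Suc_has_derivative[OF assms]])
  then have "((\<lambda>t. F (y + t *\<^sub>R e)) has_derivative (*) (pd e F (y + t *\<^sub>R e))) (at t)"
    by (rule has_derivative_eq_rhs) (auto simp: Ck_Suc_linear[OF assms])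
  then show ?thesis
    unfolding has_field_derivative_def .
qed

text \<open>The increment of \<open>f\<close> along \<open>w\<close> is the integral of
  \<open>pd w f\<close>. Differentiating it in direction \<open>v\<close> under the integral sign,
  and comparing with the increment of \<open>pd v f\<close>, shows that the two mixed derivatives
  have equal integrals over all short segments, hence equal values at the starting point.\<close>

lemma pd_commute:
  fixes f :: "'a::euclidean_space \<Rightarrow> real"
  assumes f: "Ck (Suc (Suc k)) f"
  shows "pd v (pd w f) x = pd w (pd v f) x"
proof -
  have line: "f (x + s *\<^sub>R w) = f x + integral {0..s} (\<lambda>t. pd w f (x + t *\<^sub>R w))" if "0 \<le> s" and f: "Ck (Suc k) f" for s x w k and f :: "'a \<Rightarrow> real"
  proof -
    have "((\<lambda>t. f (x + t *\<^sub>R w)) has_real_derivative pd w f (x + t *\<^sub>R w)) (at t within A)" for t A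
      by (rule has_field_derivative_at_within[OF line_has_real_derivative[OF f]])
    then have "((\<lambda>t. pd w f (x + t *\<^sub>R w)) has_integral f (x + s *\<^sub>R w) - f (x + 0 *\<^sub>R w)) {0..s}"
      using that by (intro fundamental_theorem_of_calculus)
        (auto simp: has_real_derivative_iff_has_vector_derivative)
    then show ?thesis by (simp add: integral_unique)
  qed
  have f1: "Ck (Suc k) f" and fv: "Ck (Suc k) (pd v f)" and fw: "Ck (Suc k) (pd w f)"
    by (rule Ck_pred[OF f], rule Ck_Suc_pd[OF f], rule Ck_Suc_pd[OF f])
  have "pd v (pd w f) (x + 0 *\<^sub>R w) = pd w (pd v f) (x + 0 *\<^sub>R w)"
  proof (rule integral_eq_imp_eq_at_0[where f = "\<lambda>t. pd v (pd w f) (x + t *\<^sub>R w)"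
        and g = "\<lambda>t. pd w (pd v f) (x + t *\<^sub>R w)"])
    show "continuous_on UNIV (\<lambda>t. pd v (pd w f) (x + t *\<^sub>R w))"
      "continuous_on UNIV (\<lambda>t. pd w (pd v f) (x + t *\<^sub>R w))"
      by (intro continuous_intros subset_UNIV continuous_on_compose2[OF Ck_continuous[OF Ck_Suc_pd[OF fw], of UNIV]]
          continuous_on_compose2[OF Ck_continuous[OF Ck_Suc_pd[OF fv], of UNIV]])+
    fix s :: real assume s: "0 \<le> s" "s \<le> 1"
    have "pd v f (x + s *\<^sub>R w) = pd v f x + integral {0..s} (\<lambda>t. pd v (pd w f) (x + t *\<^sub>R w))"
    proof -
      have eq: "(\<lambda>x. f (x + s *\<^sub>R w)) = (\<lambda>x. f x + integral {0..s} (\<lambda>t. pd w f (x + t *\<^sub>R w)))"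
        using line[OF s(1) f1] by auto
      have "((\<lambda>x. x + s *\<^sub>R w) has_derivative (\<lambda>x. x)) (at x)"
        by (auto intro!: derivative_eq_intros)
      then have "((\<lambda>x. f (x + s *\<^sub>R w)) has_derivative (\<lambda>v. pd v f (x + s *\<^sub>R w))) (at x)"
        by (rule has_derivative_compose[OF _ Ck_Suc_has_derivative[OF f1]])
      moreover have "((\<lambda>x. f x + integral {0..s} (\<lambda>t. pd w f (x + t *\<^sub>R w))) has_derivative
          (\<lambda>v. pd v f x + integral {0..s} (\<lambda>t. pd v (pd w f) (x + t *\<^sub>R w)))) (at x)"
        by (intro has_derivative_add Ck_Suc_has_derivative[OF f1]
            line_integral_has_derivative[OF fw, of "\<lambda>x. x"] bounded_linear_ident)
      ultimately show ?thesis
        unfolding eq by (auto dest: has_derivative_unique fun_cong)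
    qed
    moreover have "pd v f (x + s *\<^sub>R w) = pd v f x + integral {0..s} (\<lambda>t. pd w (pd v f) (x + t *\<^sub>R w))"
      by (rule line[OF s(1) fv])
    ultimately show "integral {0..s} (\<lambda>t. pd v (pd w f) (x + t *\<^sub>R w)) =
       integral {0..s} (\<lambda>t. pd w (pd v f) (x + t *\<^sub>R w))"
      by linarith
  qed
  then show ?thesis by simp
qed

section \<open>Marginals of log-concave families\<close>

text \<open>An infinitesimal Prekopa inequality on an interval, for a family with jet
  \<open>\<rho>\<close>, \<open>\<alpha>\<close>, \<open>\<beta>\<close> at s = 0. As the hypothesis
  holds for every shift \<open>\<tau>\<close>, the shift may depend on \<open>t\<close>. The choice
  \<open>- X\<close> is the velocity that transports the normalised density to first order in s;
  what remains is the growth rate \<open>m\<close> of the mass, a total derivative with vanishing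
  boundary terms, and a square of favourable sign.\<close>

lemma log_concave_family_integral_real:
  fixes \<rho> \<rho>1 \<rho>2 \<alpha> \<alpha>1 \<beta> :: "real \<Rightarrow> real"
  assumes ab: "a < b"
    and pos: "\<And>t. \<rho> t > 0"
    and d\<rho>: "\<And>t. (\<rho> has_real_derivative \<rho>1 t) (at t)"
    and d\<rho>1: "\<And>t. (\<rho>1 has_real_derivative \<rho>2 t) (at t)"
    and d\<alpha>: "\<And>t. (\<alpha> has_real_derivative \<alpha>1 t) (at t)"
    and \<beta>: "\<beta> integrable_on {a..b}"
    and conc: "\<And>t \<tau>. \<rho> t * (\<beta> t + 2 * \<tau> * \<alpha>1 t + \<tau>\<^sup>2 * \<rho>2 t) \<le> (\<alpha> t + \<tau> * \<rho>1 t)\<^sup>2"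
  shows "integral {a..b} \<rho> * integral {a..b} \<beta> \<le> (integral {a..b} \<alpha>)\<^sup>2"
proof -
  have cont: "continuous_on S \<rho>" "continuous_on S \<alpha>" for S
    using d\<rho> d\<alpha> by (meson DERIV_continuous_on has_field_derivative_at_within)+
  then have int: "\<rho> integrable_on {c..d}" "\<alpha> integrable_on {c..d}" for c d
    by (auto intro: integrable_continuous_interval)
  define J where "J = integral {a..b} \<rho>"
  have "J > 0"
  proof -
    have "J \<ge> 0" unfolding J_def using pos by (intro integral_nonneg int) (auto simp: less_imp_le)
    moreover have "J \<noteq> 0"
      unfolding J_def using integral_eq_0_iff[OF cont(1)[of "{a..b}"] ab] pos
      by (metis ab atLeastAtMost_iff less_eq_real_def less_irrefl)
    ultimately show ?thesis by simp
  qed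
  \<comment> \<open>\<open>X\<close> solves \<open>(X \<rho>)' = \<alpha> - m \<rho>\<close> with zero boundary values; at \<open>\<tau> = - X\<close> the hypothesis bounds
    \<open>\<beta>\<close> by \<open>m\<^sup>2 \<rho> - X'\<^sup>2 \<rho>\<close> plus the total derivative \<open>\<Phi>'\<close>.\<close>
  define m where "m = integral {a..b} \<alpha> / J"
  define G where "G t = integral {a..t} (\<lambda>s. \<alpha> s - m * \<rho> s)" for t
  define X where "X t = G t / \<rho> t" for t
  define X' where "X' t = (\<alpha> t - X t * \<rho>1 t) / \<rho> t - m" for t
  define \<Phi> where "\<Phi> t = 2 * X t * \<alpha> t - (X t)\<^sup>2 * \<rho>1 t" for t
  define \<Phi>' where "\<Phi>' t = 2 * X' t * \<alpha> t + 2 * X t * \<alpha>1 t - 2 * X t * X' t * \<rho>1 t - (X t)\<^sup>2 * \<rho>2 t" for t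
  have dG: "(G has_real_derivative (\<alpha> t - m * \<rho> t)) (at t within {a..b})" if "t \<in> {a..b}" for t
    unfolding G_def using that
    by (intro integral_has_real_derivative continuous_intros cont) auto
  have dX: "(X has_real_derivative X' t) (at t within {a..b})" if "t \<in> {a..b}" for t
    unfolding X_def[abs_def] X'_def using pos[of t]
    by (auto intro!: derivative_eq_intros dG that has_field_derivative_at_within[OF d\<rho>]
        simp: field_simps power2_eq_square)
  have d\<Phi>: "(\<Phi> has_real_derivative \<Phi>' t) (at t within {a..b})" if "t \<in> {a..b}" for t
    unfolding \<Phi>_def[abs_def] \<Phi>'_def
    by (auto intro!: derivative_eq_intros dX that has_field_derivative_at_within[OF d\<rho>1]
        has_field_derivative_at_within[OF d\<alpha>] simp: algebra_simps)
  have "((\<lambda>s. \<alpha> s - m * \<rho> s) has_integral integral {a..b} \<alpha> - m * J) {a..b}"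
    unfolding J_def by (intro has_integral_diff has_integral_mult_right integrable_integral int)
  then have G0: "G a = 0" "G b = 0"
    using \<open>J > 0\<close> by (auto simp: G_def m_def integral_unique)
  have "(\<Phi>' has_integral \<Phi> b - \<Phi> a) {a..b}"
    using ab d\<Phi> by (intro fundamental_theorem_of_calculus)
      (auto simp: has_real_derivative_iff_has_vector_derivative[symmetric])
  then have "((\<lambda>t. \<Phi>' t + m\<^sup>2 * \<rho> t) has_integral 0 + m\<^sup>2 * J) {a..b}"
    using G0 int by (intro has_integral_add has_integral_mult_right)
      (auto simp: \<Phi>_def X_def J_def has_integral_iff)
  moreover have "\<beta> t \<le> \<Phi>' t + m\<^sup>2 * \<rho> t" for t
  proof -
    have eq: "\<alpha> t - X t * \<rho>1 t = \<rho> t * (X' t + m)"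
      using pos[of t] by (simp add: X'_def)
    have "\<rho> t * (\<beta> t - 2 * X t * \<alpha>1 t + (X t)\<^sup>2 * \<rho>2 t) \<le> \<rho> t * (\<rho> t * (X' t + m)\<^sup>2)"
      using conc[of t "- X t"] by (simp add: eq power_mult_distrib power2_eq_square ac_simps)
    then have "\<beta> t - 2 * X t * \<alpha>1 t + (X t)\<^sup>2 * \<rho>2 t \<le> \<rho> t * (X' t + m)\<^sup>2"
      using pos[of t] by simp
    moreover have "2 * X' t * \<alpha> t - 2 * X t * X' t * \<rho>1 t = 2 * X' t * (\<rho> t * (X' t + m))"
      unfolding eq[symmetric] by (simp add: algebra_simps)
    moreover have "\<rho> t * (X' t)\<^sup>2 \<ge> 0"
      using pos[of t] by simp
    ultimately show ?thesis
      unfolding \<Phi>'_def by (simp add: power2_eq_square algebra_simps)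
  qed
  ultimately have "integral {a..b} \<beta> \<le> m\<^sup>2 * J"
    using has_integral_le[OF integrable_integral[OF \<beta>]] by fastforce
  then have "J * integral {a..b} \<beta> \<le> J * (m\<^sup>2 * J)"
    using \<open>J > 0\<close> by simp
  also have "\<dots> = (integral {a..b} \<alpha>)\<^sup>2"
    using \<open>J > 0\<close> by (simp add: m_def power2_eq_square)
  finally show ?thesis by (simp add: J_def)
qed

text \<open>The integrated coordinate stays in the type: for a unit vector \<open>e\<close> the
  result is a function on the whole space that is constant in direction \<open>e\<close>. The same
  \<open>Ck\<close> and \<open>pd\<close> apply after every integration, and an induction over
  coordinates involves no change of dimension.\<close>

definition marginal :: "real \<Rightarrow> 'a::euclidean_space \<Rightarrow> ('a \<Rightarrow> real) \<Rightarrow> 'a \<Rightarrow> real" where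
  "marginal R e F x = integral {-R..R} (\<lambda>t. F (x - (x \<bullet> e) *\<^sub>R e + t *\<^sub>R e))"

lemma marginal_Ck:
  fixes F :: "'a::euclidean_space \<Rightarrow> real"
  assumes "Ck k F"
  shows "Ck k (marginal R e F)"
  using assms
proof (induction k arbitrary: F)
  case 0
  then have F: "continuous_on UNIV F" by simp
  have "continuous_on UNIV (\<lambda>x. integral (cbox (-R) R) (\<lambda>t. F (x - (x \<bullet> e) *\<^sub>R e + t *\<^sub>R e)))"
    by (rule integral_continuous_on_param)
       (auto simp: split_beta intro!: continuous_intros continuous_on_compose2[OF F])
  then show ?case by (simp add: marginal_def[abs_def])
next
  case (Suc k)
  have "bounded_linear (\<lambda>x. x - (x \<bullet> e) *\<^sub>R e)"
    by (intro bounded_linear_intros)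
  from line_integral_has_derivative[OF Suc.prems this, of "-R" R e]
  show ?case
    unfolding marginal_def[abs_def]
    by (intro Ck_SucI[where f' = "\<lambda>v. marginal R e (pd (v - (v \<bullet> e) *\<^sub>R e) F)"]
        Suc.IH[OF Ck_Suc_pd[OF Suc.prems]]) (simp add: marginal_def)
qed

lemma pd_marginal:
  fixes F :: "'a::euclidean_space \<Rightarrow> real"
  assumes "Ck (Suc k) F"
  shows "pd v (marginal R e F) = marginal R e (pd (v - (v \<bullet> e) *\<^sub>R e) F)"
proof
  fix x
  have "bounded_linear (\<lambda>x. x - (x \<bullet> e) *\<^sub>R e)"
    by (intro bounded_linear_intros)
  from line_integral_has_derivative[OF assms this, of "-R" R e]
  show "pd v (marginal R e F) x = marginal R e (pd (v - (v \<bullet> e) *\<^sub>R e) F) x"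
    unfolding marginal_def[abs_def]
    by (rule pd_eqI)
qed

text \<open>
  The triple \<open>(\<rho>, \<alpha>, \<beta>)\<close> is the second-order jet at \<open>s = 0\<close> of a family \<open>s \<mapsto> \<rho>\<^sub>s\<close> of positive
  functions; the inequality says that the Hessian of \<open>ln \<rho>\<^sub>s(x)\<close>, jointly in \<open>(x, s)\<close>, is
  negative-semidefinite at \<open>s = 0\<close>.
\<close>

definition log_concave_jet ::
  "('a::euclidean_space \<Rightarrow> real) \<Rightarrow> ('a \<Rightarrow> real) \<Rightarrow> ('a \<Rightarrow> real) \<Rightarrow> bool" where
  "log_concave_jet \<rho> \<alpha> \<beta> \<longleftrightarrow> Ck 2 \<rho> \<and> Ck 1 \<alpha> \<and> Ck 0 \<beta> \<and> (\<forall>x. \<rho> x > 0) \<and>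
     (\<forall>x w. \<rho> x * (\<beta> x + 2 * pd w \<alpha> x + pd w (pd w \<rho>) x) \<le> (\<alpha> x + pd w \<rho> x)\<^sup>2)"

text \<open>Derivatives of a marginal along \<open>w\<close> see only the part \<open>u\<close> that
  remains after removing the \<open>e\<close> component. Shearing the family along \<open>u\<close>
  turns its jet into \<open>\<rho>\<close>, \<open>\<alpha>'\<close>, \<open>\<beta>'\<close>, and
  the directions \<open>u + \<tau> *\<^sub>R e\<close> in the hypothesis supply exactly the shifts
  \<open>\<tau>\<close> that the one-dimensional inequality demands.\<close>

lemma log_concave_jet_marginal:
  fixes \<rho> :: "'a::euclidean_space \<Rightarrow> real"
  assumes jet: "log_concave_jet \<rho> \<alpha> \<beta>" and R: "R > 0"
  shows "log_concave_jet (marginal R e \<rho>) (marginal R e \<alpha>) (marginal R e \<beta>)"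
proof -
  have \<rho>: "Ck (Suc (Suc 0)) \<rho>" and \<alpha>: "Ck (Suc 0) \<alpha>" and \<beta>: "Ck 0 \<beta>" and pos: "\<And>x. \<rho> x > 0"
    and conc: "\<And>x w. \<rho> x * (\<beta> x + 2 * pd w \<alpha> x + pd w (pd w \<rho>) x) \<le> (\<alpha> x + pd w \<rho> x)\<^sup>2"
    using jet by (simp_all only: log_concave_jet_def numeral_2_eq_2 One_nat_def)
  have \<rho>0: "Ck (Suc 0) \<rho>" and \<rho>1: "\<And>v. Ck (Suc 0) (pd v \<rho>)"
    by (rule Ck_pred[OF \<rho>], rule Ck_Suc_pd[OF \<rho>])
  have \<rho>2: "Ck 0 (pd u (pd v \<rho>))" and \<alpha>1: "Ck 0 (pd v \<alpha>)" for u v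
    by (rule Ck_Suc_pd[OF \<rho>1], rule Ck_Suc_pd[OF \<alpha>])
  have int: "(\<lambda>t. F (y + t *\<^sub>R e)) integrable_on {-R..R}" if "Ck k F" for k F and y :: 'a
    by (intro integrable_continuous_interval continuous_intros
        continuous_on_compose2[OF Ck_continuous[OF that, of UNIV]]) auto
  have pos': "marginal R e \<rho> x > 0" for x
  proof -
    let ?f = "\<lambda>t. \<rho> (x - (x \<bullet> e) *\<^sub>R e + t *\<^sub>R e)"
    have c: "continuous_on {-R..R} ?f"
      by (intro continuous_intros continuous_on_compose2[OF Ck_continuous[OF \<rho>, of UNIV]]) auto
    have "integral {-R..R} ?f \<ge> 0"
      using pos by (intro integral_nonneg int[OF \<rho>]) (auto simp: less_imp_le)
    moreover have "integral {-R..R} ?f \<noteq> 0"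
      using integral_eq_0_iff[OF c] pos R
      by (metis atLeastAtMost_iff less_eq_real_def less_irrefl neg_less_0_iff_less order_less_trans)
    ultimately show ?thesis by (simp add: marginal_def)
  qed
  have conc': "marginal R e \<rho> x * (marginal R e \<beta> x + 2 * pd w (marginal R e \<alpha>) x
        + pd w (pd w (marginal R e \<rho>)) x) \<le> (marginal R e \<alpha> x + pd w (marginal R e \<rho>) x)\<^sup>2" for x w
  proof -
    define u where "u = w - (w \<bullet> e) *\<^sub>R e"
    define y where "y = x - (x \<bullet> e) *\<^sub>R e"
    define \<alpha>' where "\<alpha>' z = \<alpha> z + pd u \<rho> z" for z
    define \<beta>' where "\<beta>' z = \<beta> z + 2 * pd u \<alpha> z + pd u (pd u \<rho>) z" for z
    have \<alpha>': "Ck (Suc 0) \<alpha>'" and \<beta>': "Ck 0 \<beta>'"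
      unfolding \<alpha>'_def[abs_def] \<beta>'_def[abs_def]
      by (intro Ck_intros \<alpha> \<beta> \<rho>1 \<rho>2 \<alpha>1)+
    have "integral {-R..R} (\<lambda>t. \<rho> (y + t *\<^sub>R e)) * integral {-R..R} (\<lambda>t. \<beta>' (y + t *\<^sub>R e))
        \<le> (integral {-R..R} (\<lambda>t. \<alpha>' (y + t *\<^sub>R e)))\<^sup>2"
    proof (rule log_concave_family_integral_real)
      show "-R < R" using R by simp
      fix t \<tau> :: real
      let ?z = "y + t *\<^sub>R e"
      show "\<rho> ?z > 0" by (rule pos)
      show "((\<lambda>t. \<rho> (y + t *\<^sub>R e)) has_real_derivative pd e \<rho> ?z) (at t)"
        "((\<lambda>t. pd e \<rho> (y + t *\<^sub>R e)) has_real_derivative pd e (pd e \<rho>) ?z) (at t)"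
        "((\<lambda>t. \<alpha>' (y + t *\<^sub>R e)) has_real_derivative pd e \<alpha>' ?z) (at t)"
        by (rule line_has_real_derivative[OF \<rho>] line_has_real_derivative[OF \<rho>1]
            line_has_real_derivative[OF \<alpha>'])+
      show "(\<lambda>t. \<beta>' (y + t *\<^sub>R e)) integrable_on {-R..R}" by (rule int[OF \<beta>'])
      \<comment> \<open>Symmetry of second derivatives merges the two cross terms.\<close>
      have "pd (u + \<tau> *\<^sub>R e) (pd (u + \<tau> *\<^sub>R e) \<rho>) ?z =
          pd u (pd u \<rho>) ?z + 2 * \<tau> * pd e (pd u \<rho>) ?z + \<tau>\<^sup>2 * pd e (pd e \<rho>) ?z"
      proof -
        have "pd (u + \<tau> *\<^sub>R e) \<rho> = (\<lambda>z. pd u \<rho> z + \<tau> * pd e \<rho> z)"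
          using Ck_Suc_linear[OF \<rho>] by auto
        moreover have "Ck (Suc 0) (\<lambda>z. \<tau> * pd e \<rho> z)"
          by (intro Ck_intros \<rho>1)
        ultimately have "pd v (pd (u + \<tau> *\<^sub>R e) \<rho>) ?z = pd v (pd u \<rho>) ?z + \<tau> * pd v (pd e \<rho>) ?z" for v
          using \<rho>1 by (simp add: pd_add pd_cmult)
        then show ?thesis
          using pd_commute[OF \<rho>, where v = u and w = e and x = ?z]
          by (simp add: Ck_Suc_linear[OF \<rho>1] power2_eq_square algebra_simps)
      qed
      moreover have "pd e \<alpha>' ?z = pd e \<alpha> ?z + pd e (pd u \<rho>) ?z"
        unfolding \<alpha>'_def[abs_def] using \<rho>1 \<alpha> by (simp add: pd_add)
      ultimately have *: "\<beta>' ?z + 2 * \<tau> * pd e \<alpha>' ?z + \<tau>\<^sup>2 * pd e (pd e \<rho>) ?z =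
          \<beta> ?z + 2 * pd (u + \<tau> *\<^sub>R e) \<alpha> ?z + pd (u + \<tau> *\<^sub>R e) (pd (u + \<tau> *\<^sub>R e) \<rho>) ?z"
        by (simp add: \<beta>'_def Ck_Suc_linear[OF \<alpha>] algebra_simps)
      have "\<alpha>' ?z + \<tau> * pd e \<rho> ?z = \<alpha> ?z + pd (u + \<tau> *\<^sub>R e) \<rho> ?z"
        by (simp add: \<alpha>'_def Ck_Suc_linear[OF \<rho>])
      with * conc[of ?z "u + \<tau> *\<^sub>R e"]
      show "\<rho> ?z * (\<beta>' ?z + 2 * \<tau> * pd e \<alpha>' ?z + \<tau>\<^sup>2 * pd e (pd e \<rho>) ?z) \<le> (\<alpha>' ?z + \<tau> * pd e \<rho> ?z)\<^sup>2"
        by simp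
    qed
    moreover have "pd w (marginal R e \<rho>) x = marginal R e (pd u \<rho>) x"
      "pd w (marginal R e \<alpha>) x = marginal R e (pd u \<alpha>) x"
      using pd_marginal[OF \<rho>0, THEN fun_cong] pd_marginal[OF \<alpha>, THEN fun_cong] by (simp_all only: u_def)
    moreover have "pd w (pd w (marginal R e \<rho>)) x = marginal R e (pd u (pd u \<rho>)) x"
      using pd_marginal[OF \<rho>1, THEN fun_cong] by (simp only: u_def pd_marginal[OF \<rho>0])
    moreover have "integral {-R..R} (\<lambda>t. \<alpha>' (y + t *\<^sub>R e)) = marginal R e \<alpha> x + marginal R e (pd u \<rho>) x"
      unfolding \<alpha>'_def marginal_def y_def[symmetric]
      by (intro integral_add int[OF \<alpha>] int[OF \<rho>1])
    moreover have "integral {-R..R} (\<lambda>t. \<beta>' (y + t *\<^sub>R e)) = marginal R e \<beta> x +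
        2 * marginal R e (pd u \<alpha>) x + marginal R e (pd u (pd u \<rho>)) x"
      unfolding \<beta>'_def marginal_def y_def[symmetric]
      by (intro integral_unique has_integral_add has_integral_mult_right integrable_integral
          int[OF \<beta>] int[OF \<alpha>1] int[OF \<rho>2])
    moreover have "marginal R e \<rho> x = integral {-R..R} (\<lambda>t. \<rho> (y + t *\<^sub>R e))"
      by (simp add: marginal_def y_def)
    ultimately show ?thesis by (simp only:)
  qed
  have "Ck 2 (marginal R e \<rho>)" "Ck 1 (marginal R e \<alpha>)" "Ck 0 (marginal R e \<beta>)"
    using marginal_Ck[OF \<rho>] marginal_Ck[OF \<alpha>] marginal_Ck[OF \<beta>]
    by (simp_all only: numeral_2_eq_2 One_nat_def)
  then show ?thesis
    unfolding log_concave_jet_def by (intro conjI allI pos' conc')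
qed

section \<open>Integrals over cubes, one coordinate at a time\<close>

definition box_integral :: "'a::euclidean_space set \<Rightarrow> real \<Rightarrow> ('a \<Rightarrow> real) \<Rightarrow> real" where
  "box_integral J R F =
     (\<integral>f. F (\<Sum>c\<in>J. f c *\<^sub>R c) * (\<Prod>c\<in>J. indicat_real {-R..R} (f c)) \<partial>Pi\<^sub>M J (\<lambda>_. lborel))"

interpretation lborel_family: product_sigma_finite "\<lambda>_::'a::euclidean_space. lborel :: real measure"
  by standard

text \<open>All points of the box lie in a ball, where the continuous \<open>F\<close> is bounded; a
  multiple of the indicator of the box therefore dominates.\<close>

lemma integrable_box_integral:
  fixes F :: "'a::euclidean_space \<Rightarrow> real"
  assumes J: "finite J" and F: "continuous_on UNIV F"
  shows "integrable (Pi\<^sub>M J (\<lambda>_. lborel))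
           (\<lambda>f. F (\<Sum>c\<in>J. f c *\<^sub>R c) * (\<Prod>c\<in>J. indicat_real {-R..R} (f c)))"
proof -
  define r where "r = (\<Sum>c\<in>J. \<bar>R\<bar> * norm c)"
  have "bounded (F ` cball 0 r)"
    by (intro compact_imp_bounded compact_continuous_image continuous_on_subset[OF F]) auto
  then obtain B where B: "\<And>x. x \<in> cball 0 r \<Longrightarrow> \<bar>F x\<bar> \<le> B"
    unfolding bounded_iff by (metis image_eqI real_norm_def)
  have [measurable]: "F \<in> borel_measurable borel"
    using F by (rule borel_measurable_continuous_onI)
  have "integrable (Pi\<^sub>M J (\<lambda>_. lborel)) (\<lambda>f. B * (\<Prod>c\<in>J. indicat_real {-R..R} (f c)))"
    by (intro integrable_mult_right lborel_family.product_integrable_prod J)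
       (simp add: emeasure_lborel_Icc_eq)
  then show ?thesis
  proof (rule Bochner_Integration.integrable_bound)
    show "AE f in Pi\<^sub>M J (\<lambda>_. lborel). norm (F (\<Sum>c\<in>J. f c *\<^sub>R c) * (\<Prod>c\<in>J. indicat_real {-R..R} (f c)))
        \<le> norm (B * (\<Prod>c\<in>J. indicat_real {-R..R} (f c)))"
    proof (intro AE_I2)
      fix f :: "'a \<Rightarrow> real"
      show "norm (F (\<Sum>c\<in>J. f c *\<^sub>R c) * (\<Prod>c\<in>J. indicat_real {-R..R} (f c)))
        \<le> norm (B * (\<Prod>c\<in>J. indicat_real {-R..R} (f c)))"
      proof (cases "\<forall>c\<in>J. f c \<in> {-R..R}")
        case True
        have "norm (\<Sum>c\<in>J. f c *\<^sub>R c) \<le> r"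
          unfolding r_def using True by (intro sum_norm_le) (fastforce intro!: mult_right_mono)
        then show ?thesis
          using B[of "\<Sum>c\<in>J. f c *\<^sub>R c"] True by simp
      next
        case False
        then obtain c where "c \<in> J" "f c \<notin> {-R..R}" by blast
        then have "(\<Prod>c\<in>J. indicat_real {-R..R} (f c)) = 0"
          by (intro prod_zero J bexI[of _ c]) auto
        then show ?thesis by simp
      qed
    qed
  qed measurable
qed

text \<open>Fubini's theorem for the coordinate \<open>e\<close>. In \<open>box_integral\<close> the
  coordinates outside \<open>J\<close> are 0, so shrinking \<open>J\<close> interpolates between the
  integral over the full cube and the value at the origin.\<close>

lemma box_integral_insert:
  fixes F :: "'a::euclidean_space \<Rightarrow> real"
  assumes J: "finite J" "e \<notin> J" "insert e J \<subseteq> Basis" and F: "continuous_on UNIV F"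
  shows "box_integral (insert e J) R F = box_integral J R (marginal R e F)"
proof -
  have "box_integral (insert e J) R F = (\<integral>x. (\<integral>y. F (\<Sum>c\<in>insert e J. (x(e := y)) c *\<^sub>R c) *
      (\<Prod>c\<in>insert e J. indicat_real {-R..R} ((x(e := y)) c)) \<partial>lborel) \<partial>Pi\<^sub>M J (\<lambda>_. lborel))"
    unfolding box_integral_def
    using J F by (intro lborel_family.product_integral_insert integrable_box_integral) auto
  also have "\<dots> = box_integral J R (marginal R e F)"
    unfolding box_integral_def
  proof (intro Bochner_Integration.integral_cong refl)
    fix x :: "'a \<Rightarrow> real"
    define z where "z = (\<Sum>c\<in>J. x c *\<^sub>R c)"
    \<comment> \<open>By orthogonality of the basis a point built from \<open>J\<close> has no
      \<open>e\<close> component, so the subtraction inside \<open>marginal\<close> has no effect at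
      \<open>z\<close>.\<close>
    have "z \<bullet> e = 0"
      unfolding z_def inner_sum_left using J by (intro sum.neutral) (metis inner_not_same_Basis inner_scaleR_left insert_subset mult_zero_right subsetD)
    then have "marginal R e F z = integral {-R..R} (\<lambda>t. F (z + t *\<^sub>R e))"
      by (simp add: marginal_def)
    also have "\<dots> = (\<integral>t. indicat_real {-R..R} t * F (z + t *\<^sub>R e) \<partial>lborel)"
    proof -
      have "set_integrable lborel {-R..R} (\<lambda>t. F (z + t *\<^sub>R e))"
        by (intro borel_integrable_atLeastAtMost' continuous_on_compose2[OF F] continuous_intros) auto
      from set_borel_integral_eq_integral(2)[OF this]
      show ?thesis by (simp add: set_lebesgue_integral_def)
    qed
    finally have *: "marginal R e F z = (\<integral>t. indicat_real {-R..R} t * F (z + t *\<^sub>R e) \<partial>lborel)" .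
    have sum: "(\<Sum>c\<in>insert e J. (x(e := y)) c *\<^sub>R c) = z + y *\<^sub>R e" for y
      unfolding z_def using J by (subst sum.insert) (auto intro!: sum.cong simp: add.commute)
    have prod: "(\<Prod>c\<in>insert e J. indicat_real {-R..R} ((x(e := y)) c)) =
        indicat_real {-R..R} y * (\<Prod>c\<in>J. indicat_real {-R..R} (x c))" for y
      using J by (subst prod.insert) (auto intro!: prod.cong)
    show "(\<integral>y. F (\<Sum>c\<in>insert e J. (x(e := y)) c *\<^sub>R c) *
      (\<Prod>c\<in>insert e J. indicat_real {-R..R} ((x(e := y)) c)) \<partial>lborel) =
      marginal R e F (\<Sum>c\<in>J. x c *\<^sub>R c) * (\<Prod>c\<in>J. indicat_real {-R..R} (x c))"
      unfolding sum prod z_def[symmetric] *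
      by (simp only: mult.left_commute mult.assoc[symmetric] Bochner_Integration.integral_mult_left_zero
          mult.commute[of "F _"])
  qed
  finally show ?thesis .
qed

lemma box_integral_Basis:
  fixes F :: "'a::euclidean_space \<Rightarrow> real"
  assumes F: "continuous_on UNIV F"
  shows "box_integral Basis R F = (\<integral>x. F x * (\<Prod>c\<in>Basis. indicat_real {-R..R} (x \<bullet> c)) \<partial>lborel)"
proof -
  have [measurable]: "F \<in> borel_measurable borel"
    using F by (rule borel_measurable_continuous_onI)
  have "(\<integral>x. F x * (\<Prod>c\<in>Basis. indicat_real {-R..R} (x \<bullet> c)) \<partial>lborel) =
     (\<integral>f. F (\<Sum>c\<in>Basis. f c *\<^sub>R c) * (\<Prod>c\<in>Basis. indicat_real {-R..R} ((\<Sum>c\<in>Basis. f c *\<^sub>R c) \<bullet> c))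
        \<partial>Pi\<^sub>M Basis (\<lambda>_. lborel))"
    by (subst lborel_eq, subst integral_distr) auto
  also have "\<dots> = box_integral Basis R F"
    unfolding box_integral_def
    by (intro Bochner_Integration.integral_cong refl arg_cong2[where f = "(*)"] prod.cong)
       (simp add: inner_sum_left_Basis)
  finally show ?thesis by simp
qed

text \<open>Integrating out a coordinate preserves the jet inequality but changes the triple, hence
  the generalisation over all three functions. Once no coordinate is left, the direction 0 reduces
  the inequality to \<open>\<rho> 0 * \<beta> 0 \<le> (\<alpha> 0)\<^sup>2\<close>.\<close>

lemma box_integral_log_concave_jet:
  assumes "finite J" "J \<subseteq> Basis" "log_concave_jet \<rho> \<alpha> \<beta>" and R: "R > 0"
  shows "box_integral J R \<rho> * box_integral J R \<beta> \<le> (box_integral J R \<alpha>)\<^sup>2"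
  using assms(1-3)
proof (induction J arbitrary: \<rho> \<alpha> \<beta> rule: finite_induct)
  case empty
  have 0: "pd 0 f x = 0" if "Ck (Suc 0) f" for f :: "'a \<Rightarrow> real" and x
    using Ck_Suc_linear(2)[OF that, where c = 0 and v = 0 and x = x] by (metis mult_zero_left scaleR_zero_left)
  have \<rho>: "Ck (Suc (Suc 0)) \<rho>" and \<alpha>: "Ck (Suc 0) \<alpha>"
    and conc: "\<rho> 0 * (\<beta> 0 + 2 * pd 0 \<alpha> 0 + pd 0 (pd 0 \<rho>) 0) \<le> (\<alpha> 0 + pd 0 \<rho> 0)\<^sup>2"
    using empty(2) by (simp_all only: log_concave_jet_def numeral_2_eq_2 One_nat_def)
  from conc have "\<rho> 0 * \<beta> 0 \<le> (\<alpha> 0)\<^sup>2"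
    by (simp only: 0[OF \<alpha>] 0[OF Ck_pred[OF \<rho>]] 0[OF Ck_Suc_pd[OF \<rho>]]) simp
  \<comment> \<open>The product measure over the empty index set is a point mass, the empty sum is 0
    and the empty product is 1.\<close>
  moreover have "box_integral {} R F = F 0" for F :: "'a \<Rightarrow> real"
    by (simp add: box_integral_def PiM_empty lebesgue_integral_count_space_finite)
  ultimately show ?case by simp
next
  case (insert e J)
  have "continuous_on UNIV \<rho>" "continuous_on UNIV \<alpha>" "continuous_on UNIV \<beta>"
    using insert.prems(2) unfolding log_concave_jet_def
    by (auto simp del: Ck_on.simps intro: Ck_continuous)
  with insert show ?case
    by (simp add: box_integral_insert log_concave_jet_marginal R)
qed

section \<open>The Brascamp--Lieb inequality\<close>

lemma box_indicator_tendsto: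
  fixes x :: "'a::euclidean_space"
  shows "(\<lambda>k. F x * (\<Prod>c\<in>Basis. indicat_real {- real (Suc k)..real (Suc k)} (x \<bullet> c))) \<longlonglongrightarrow> F x"
proof (rule tendsto_eventually)
  obtain K :: nat where K: "norm x \<le> real K"
    using real_arch_simple by blast
  show "\<forall>\<^sub>F k in sequentially. F x * (\<Prod>c\<in>Basis. indicat_real {- real (Suc k)..real (Suc k)} (x \<bullet> c)) = F x"
    using eventually_ge_at_top[of K]
  proof eventually_elim
    case (elim k)
    have "indicat_real {- real (Suc k)..real (Suc k)} (x \<bullet> c) = 1" if "c \<in> Basis" for c
      using Basis_le_norm[OF that, of x] K elim by (auto simp: indicator_def abs_le_iff)
    then show ?case by simp
  qed
qed

lemma box_integral_tendsto:
  fixes F :: "'a::euclidean_space \<Rightarrow> real"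
  assumes F: "continuous_on UNIV F" and int: "integrable lborel F"
  shows "(\<lambda>k. box_integral Basis (real (Suc k)) F) \<longlonglongrightarrow> (\<integral>x. F x \<partial>lborel)"
  unfolding box_integral_Basis[OF F]
proof (rule integral_dominated_convergence[where w = "\<lambda>x. norm (F x)"])
  show "AE x in lborel. (\<lambda>k. F x * (\<Prod>c\<in>Basis. indicat_real {- real (Suc k)..real (Suc k)} (x \<bullet> c))) \<longlonglongrightarrow> F x"
    by (intro AE_I2 box_indicator_tendsto)
  have "\<bar>\<Prod>c\<in>Basis. indicat_real {- real (Suc k)..real (Suc k)} (x \<bullet> c)\<bar> \<le> 1" for k and x :: 'a
    unfolding abs_prod by (intro prod_le_1) auto
  then show "AE x in lborel. norm (F x * (\<Prod>c\<in>Basis. indicat_real {- real (Suc k)..real (Suc k)} (x \<bullet> c)))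
      \<le> norm (F x)" for k
    by (intro AE_I2) (simp add: abs_mult mult_left_le)
  have [measurable]: "F \<in> borel_measurable borel"
    using F by (rule borel_measurable_continuous_onI)
  show "(\<lambda>x. F x * (\<Prod>c\<in>Basis. indicat_real {- real (Suc k)..real (Suc k)} (x \<bullet> c))) \<in> borel_measurable lborel" for k
    by measurable
qed (use int in auto)

text \<open>
  The hypothesis on \<open>Q\<close> says \<open>\<nabla>f \<bullet> (\<nabla>\<^sup>2\<psi>)\<^sup>-\<^sup>1 \<nabla>f \<le> Q\<close>, written so that the Hessian need not be
  invertible.
\<close>

theorem brascamp_lieb:
  fixes \<psi> f Q :: "'a::euclidean_space \<Rightarrow> real"
  assumes \<psi>: "Ck 2 \<psi>" and f: "Ck 1 f" and Q: "Ck 0 Q"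
    and nonneg: "\<And>x w. 0 \<le> Q x + 2 * pd w f x + pd w (pd w \<psi>) x"
    and int: "integrable lborel (\<lambda>x. exp (- \<psi> x))"
      "integrable lborel (\<lambda>x. f x * exp (- \<psi> x))"
      "integrable lborel (\<lambda>x. ((f x)\<^sup>2 - Q x) * exp (- \<psi> x))"
  shows "(\<integral>x. exp (- \<psi> x) \<partial>lborel) * (\<integral>x. ((f x)\<^sup>2 - Q x) * exp (- \<psi> x) \<partial>lborel)
           \<le> (\<integral>x. f x * exp (- \<psi> x) \<partial>lborel)\<^sup>2"
proof -
  \<comment> \<open>This is the jet at s = 0 of exp(-\<psi> + s f - s^2 Q / 2). The claim says that
    the logarithm of its total integral has nonpositive second derivative at s = 0.\<close>
  let ?\<rho> = "\<lambda>x. exp (- \<psi> x)" and ?\<alpha> = "\<lambda>x. f x * exp (- \<psi> x)"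
  let ?\<beta> = "\<lambda>x. ((f x)\<^sup>2 - Q x) * exp (- \<psi> x)"
  have \<psi>2: "Ck (Suc (Suc 0)) \<psi>" and f1: "Ck (Suc 0) f"
    using \<psi> f by (simp_all only: numeral_2_eq_2 One_nat_def)
  have \<psi>1: "Ck (Suc 0) \<psi>" and \<psi>w: "\<And>w. Ck (Suc 0) (pd w \<psi>)"
    by (rule Ck_pred[OF \<psi>2], rule Ck_Suc_pd[OF \<psi>2])
  have \<rho>1: "Ck (Suc 0) ?\<rho>"
    by (intro Ck_intros \<psi>1)
  have diff: "\<psi> differentiable at x" "f differentiable at x" "pd w \<psi> differentiable at x"
    "?\<rho> differentiable at x" for x w
    using \<psi>1 \<psi>w[of w] f1 \<rho>1 by auto
  have p\<rho>: "pd w ?\<rho> = (\<lambda>x. - (?\<rho> x * pd w \<psi> x))" for w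
    using pd_exp_minus[OF diff(1)] by blast
  have p\<rho>2: "pd w (pd w ?\<rho>) x = ?\<rho> x * ((pd w \<psi> x)\<^sup>2 - pd w (pd w \<psi>) x)" for w x
  proof -
    have "pd w (\<lambda>x. -1 * (?\<rho> x * pd w \<psi> x)) x = -1 * pd w (\<lambda>x. ?\<rho> x * pd w \<psi> x) x"
      by (intro pd_cmult differentiable_mult diff)
    also have "pd w (\<lambda>x. ?\<rho> x * pd w \<psi> x) x = ?\<rho> x * pd w (pd w \<psi>) x + pd w ?\<rho> x * pd w \<psi> x"
      by (intro pd_mult diff)
    finally have "pd w (\<lambda>x. - (?\<rho> x * pd w \<psi> x)) x =
        - (?\<rho> x * pd w (pd w \<psi>) x + pd w ?\<rho> x * pd w \<psi> x)"
      by simp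
    then show ?thesis
      unfolding p\<rho> fun_cong[OF p\<rho>] by (simp add: power2_eq_square algebra_simps)
  qed
  have p\<alpha>: "pd w ?\<alpha> x = f x * pd w ?\<rho> x + pd w f x * ?\<rho> x" for w x
    by (intro pd_mult diff)
  have jet: "log_concave_jet ?\<rho> ?\<alpha> ?\<beta>"
    unfolding log_concave_jet_def power2_eq_square
  proof (intro conjI allI)
    show "Ck 2 ?\<rho>" "Ck 1 ?\<alpha>" "Ck 0 (\<lambda>x. (f x * f x - Q x) * ?\<rho> x)"
      by (intro Ck_intros \<psi> f Q Ck_mono[OF \<psi>] Ck_mono[OF f]; simp del: Ck_on.simps)+
    fix x w
    \<comment> \<open>In the exponent \<open>f\<close> and \<open>\<psi>\<close> carry opposite
      signs, so the direction \<open>w\<close> of the jet corresponds to \<open>- w\<close> in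
      \<open>nonneg\<close>.\<close>
    have "(f x * f x - Q x) * ?\<rho> x + 2 * pd w ?\<alpha> x + pd w (pd w ?\<rho>) x =
       ?\<rho> x * ((f x - pd w \<psi> x)\<^sup>2 - (Q x + 2 * pd (- w) f x + pd (- w) (pd (- w) \<psi>) x))"
    proof -
      have neg: "pd (- w) g z = - pd w g z" if "Ck (Suc 0) g" for g z
        using Ck_Suc_linear(2)[OF that, where c = "-1" and v = w and x = z] by simp
      have "pd (- w) (pd (- w) \<psi>) x = pd (- w) (\<lambda>z. -1 * pd w \<psi> z) x"
        by (simp add: neg[OF \<psi>1])
      also have "\<dots> = - pd (- w) (pd w \<psi>) x"
        by (subst pd_cmult[OF diff(3)]) simp
      finally have "pd (- w) (pd (- w) \<psi>) x = pd w (pd w \<psi>) x"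
        by (simp add: neg[OF \<psi>w])
      then show ?thesis
        unfolding p\<alpha> p\<rho>2 neg[OF f1]
        unfolding fun_cong[OF p\<rho>] by (simp add: power2_eq_square algebra_simps)
    qed
    also have "\<dots> \<le> ?\<rho> x * (f x - pd w \<psi> x)\<^sup>2"
      using nonneg[of x "- w"] by (intro mult_left_mono) auto
    finally have "?\<rho> x * ((f x * f x - Q x) * ?\<rho> x + 2 * pd w ?\<alpha> x + pd w (pd w ?\<rho>) x)
       \<le> ?\<rho> x * (?\<rho> x * (f x - pd w \<psi> x)\<^sup>2)"
      by (intro mult_left_mono) auto
    then show "?\<rho> x * ((f x * f x - Q x) * ?\<rho> x + 2 * pd w ?\<alpha> x + pd w (pd w ?\<rho>) x)
       \<le> (?\<alpha> x + pd w ?\<rho> x) * (?\<alpha> x + pd w ?\<rho> x)"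
      unfolding fun_cong[OF p\<rho>] by (simp add: power2_eq_square algebra_simps)
  qed simp
  have cont: "continuous_on UNIV ?\<rho>" "continuous_on UNIV ?\<alpha>" "continuous_on UNIV ?\<beta>"
    using jet unfolding log_concave_jet_def by (auto simp del: Ck_on.simps intro: Ck_continuous)
  show ?thesis
  proof (rule LIMSEQ_le)
    show "(\<lambda>k. box_integral Basis (real (Suc k)) ?\<rho> * box_integral Basis (real (Suc k)) ?\<beta>)
       \<longlonglongrightarrow> (\<integral>x. ?\<rho> x \<partial>lborel) * (\<integral>x. ?\<beta> x \<partial>lborel)"
      by (intro tendsto_mult box_integral_tendsto cont int)
    show "(\<lambda>k. (box_integral Basis (real (Suc k)) ?\<alpha>)\<^sup>2) \<longlonglongrightarrow> (\<integral>x. ?\<alpha> x \<partial>lborel)\<^sup>2"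
      by (intro tendsto_power box_integral_tendsto cont int)
    show "\<exists>N. \<forall>k\<ge>N. box_integral Basis (real (Suc k)) ?\<rho> * box_integral Basis (real (Suc k)) ?\<beta>
        \<le> (box_integral Basis (real (Suc k)) ?\<alpha>)\<^sup>2"
      by (intro exI allI impI box_integral_log_concave_jet jet) auto
  qed
qed

section \<open>Integration by parts\<close>

text \<open>By translation invariance every difference quotient has integral 0. The mean value
  theorem and the bounded support give one integrable bound for all step sizes up to 1, and
  dominated convergence passes to the derivative.\<close>

lemma integral_pd_compact_support:
  fixes g :: "'a::euclidean_space \<Rightarrow> real"
  assumes g: "Ck (Suc k) g" and supp: "\<And>x. norm x > R \<Longrightarrow> g x = 0"
  shows "integrable lborel (pd v g)" "(\<integral>x. pd v g x \<partial>lborel) = 0"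
proof -
  define t where "t k = 1 / real (Suc k)" for k
  have t: "0 < t k" "t k \<le> 1" for k
    by (auto simp: t_def)
  have t0: "filterlim t (at 0) sequentially"
    unfolding filterlim_at using t LIMSEQ_Suc[OF lim_1_over_n[where 'a = real]]
    by (auto simp: t_def[abs_def] less_imp_neq[THEN not_sym])
  let ?r = "R + norm v"
  define D where "D k x = (g (t k *\<^sub>R v + x) - g x) / t k" for k x
  have [measurable]: "g \<in> borel_measurable borel" "pd v g \<in> borel_measurable borel"
    by (rule Ck_measurable[OF g], rule Ck_measurable[OF Ck_Suc_pd[OF g]])
  \<comment> \<open>One \<open>norm v\<close> accounts for the support of the difference quotient,
    the other for the distance from \<open>x\<close> to the intermediate point of the mean value
    theorem.\<close>
  have "bounded (pd v g ` cball 0 (R + 2 * norm v))"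
    by (intro compact_imp_bounded compact_continuous_image Ck_continuous[OF Ck_Suc_pd[OF g]]) auto
  then obtain B where B: "\<And>x. x \<in> cball 0 (R + 2 * norm v) \<Longrightarrow> \<bar>pd v g x\<bar> \<le> B"
    unfolding bounded_iff by (metis image_eqI real_norm_def)
  have "bounded (g ` cball 0 R)"
    by (intro compact_imp_bounded compact_continuous_image Ck_continuous[OF g]) auto
  then obtain B' where B': "\<And>x. x \<in> cball 0 R \<Longrightarrow> \<bar>g x\<bar> \<le> B'"
    unfolding bounded_iff by (metis image_eqI real_norm_def)
  have intg: "integrable lborel g"
  proof (rule Bochner_Integration.integrable_bound)
    show "integrable lborel (\<lambda>x. indicator (cball 0 R) x * B' :: real)"
      by (intro integrable_mult_left integrable_real_indicator emeasure_lborel_cball_finite) auto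
    show "AE x in lborel. norm (g x) \<le> norm (indicator (cball 0 R) x * B')"
      using B' supp by (intro AE_I2) (force simp: indicator_def)
  qed measurable
  have intgt: "integrable lborel (\<lambda>x. g (c + x))" "(\<integral>x. g (c + x) \<partial>lborel) = (\<integral>x. g x \<partial>lborel)" for c
    using intg integrable_distr_eq[of "(+) c" lborel borel g] integral_distr[of "(+) c" lborel borel g]
    by (auto simp: lborel_distr_plus)
  have D0: "(\<integral>x. D k x \<partial>lborel) = 0" for k
    unfolding D_def by (simp add: intgt intg)
  have lim: "(\<lambda>k. D k x) \<longlonglongrightarrow> pd v g x" for x
  proof -
    have "((\<lambda>h. (g (x + h *\<^sub>R v) - g x) / h) \<longlongrightarrow> pd v g x) (at 0)"
      using line_has_real_derivative[OF g, of x v 0] by (simp add: DERIV_def)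
    from filterlim_compose[OF this t0] show ?thesis
      by (simp add: D_def add.commute)
  qed
  have bound: "\<bar>D k x\<bar> \<le> indicator (cball 0 ?r) x * B" for k x
  proof (cases "norm x \<le> ?r")
    case True
    obtain z where z: "0 < z" "z < t k" "g (x + t k *\<^sub>R v) - g (x + 0 *\<^sub>R v) = (t k - 0) * pd v g (x + z *\<^sub>R v)"
      using MVT2[OF t(1)[of k] line_has_real_derivative[OF g, of x v]] by blast
    have "norm (x + z *\<^sub>R v) \<le> norm x + z * norm v"
      using z norm_triangle_ineq[of x "z *\<^sub>R v"] by simp
    also have "z * norm v \<le> 1 * norm v"
      using z t[of k] by (intro mult_right_mono) auto
    finally have "norm (x + z *\<^sub>R v) \<le> R + 2 * norm v" using True by simp
    then have "\<bar>pd v g (x + z *\<^sub>R v)\<bar> \<le> B" by (intro B) simp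
    moreover have "D k x = pd v g (x + z *\<^sub>R v)"
      unfolding D_def using z(3) t(1)[of k] by (simp add: add.commute)
    ultimately show ?thesis using True by simp
  next
    case False
    have "t k * norm v \<le> 1 * norm v"
      using t[of k] by (intro mult_right_mono) auto
    moreover have "norm x \<le> norm (t k *\<^sub>R v + x) + t k * norm v"
      using norm_triangle_ineq4[of "t k *\<^sub>R v + x" "t k *\<^sub>R v"] t[of k] by simp
    ultimately have "norm (t k *\<^sub>R v + x) > R" "norm x > R"
      using False norm_ge_zero[of v] by linarith+
    then show ?thesis
      using supp False by (simp add: D_def)
  qed
  have intB: "integrable lborel (\<lambda>x. indicator (cball 0 ?r) x * B :: real)"
    by (intro integrable_mult_left integrable_real_indicator emeasure_lborel_cball_finite) auto
  note dom = intB AE_I2[OF lim] AE_I2[OF bound[folded real_norm_def]]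
  have [measurable]: "D k \<in> borel_measurable borel" for k
    unfolding D_def[abs_def] by measurable
  show "integrable lborel (pd v g)"
    by (rule integrable_dominated_convergence[OF _ _ dom]) measurable
  have "(\<lambda>k. \<integral>x. D k x \<partial>lborel) \<longlonglongrightarrow> (\<integral>x. pd v g x \<partial>lborel)"
    by (rule integral_dominated_convergence[OF _ _ dom]) measurable
  then show "(\<integral>x. pd v g x \<partial>lborel) = 0"
    unfolding D0 by (simp add: LIMSEQ_const_iff)
qed

section \<open>A continuously differentiable cutoff\<close>

lemma DERIV_max_0_power2:
  "((\<lambda>s::real. (max 0 s)\<^sup>2) has_real_derivative 2 * max 0 s) (at s)"
proof (cases s "0::real" rule: linorder_cases)
  case less
  have "((\<lambda>s::real. 0) has_real_derivative 2 * max 0 s) (at s)"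
    using less by auto
  then show ?thesis
    by (rule has_field_derivative_transform_within_open[where S = "{..<0}"]) (use less in auto)
next
  case greater
  have "((\<lambda>s::real. s\<^sup>2) has_real_derivative 2 * max 0 s) (at s)"
    using greater by (auto intro!: derivative_eq_intros)
  then show ?thesis
    by (rule has_field_derivative_transform_within_open[where S = "{0<..}"]) (use greater in auto)
next
  case equal
  have "((\<lambda>h::real. (max 0 h)\<^sup>2 / h) \<longlongrightarrow> 0) (at 0)"
  proof (rule Lim_null_comparison)
    show "\<forall>\<^sub>F h::real in at 0. norm ((max 0 h)\<^sup>2 / h) \<le> \<bar>h\<bar>"
      by (intro always_eventually) (auto simp: max_def power2_eq_square)
    show "(abs \<longlongrightarrow> (0::real)) (at 0)"
      by (intro tendsto_rabs_zero) auto
  qed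
  with equal show ?thesis by (simp add: DERIV_def)
qed

text \<open>Squaring the truncated paraboloid makes it continuously differentiable across the sphere
  of radius \<open>N\<close>. One derivative is enough, since the product rule in the divergence
  theorem places only a first derivative on the cutoff, and that derivative is of order 1/N.\<close>

definition cutoff :: "real \<Rightarrow> 'a::euclidean_space \<Rightarrow> real" where
  "cutoff N x = (max 0 (1 - (x \<bullet> x) / N\<^sup>2))\<^sup>2"

lemma cutoff_has_derivative:
  "(cutoff N has_derivative (\<lambda>v. 2 * max 0 (1 - (x \<bullet> x) / N\<^sup>2) * (- 2 * (x \<bullet> v) / N\<^sup>2))) (at x)"
proof -
  have "((\<lambda>x. 1 - (x \<bullet> x) / N\<^sup>2) has_derivative (\<lambda>v. - 2 * (x \<bullet> v) / N\<^sup>2)) (at x)"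
  proof -
    have "((\<lambda>x. 1 - (x \<bullet> x) * c) has_derivative (\<lambda>v. - 2 * (x \<bullet> v) * c)) (at x)" for c
      by (auto intro!: derivative_eq_intros simp: inner_commute)
    then show ?thesis by (simp only: divide_inverse)
  qed
  then show ?thesis
    unfolding cutoff_def[abs_def]
    by (rule has_derivative_compose[OF _ DERIV_max_0_power2[unfolded has_field_derivative_def]])
qed

lemma Ck_cutoff: "Ck (Suc 0) (cutoff N)"
  by (rule Ck_SucI[OF cutoff_has_derivative]) (auto simp: divide_inverse intro!: continuous_intros)

lemma cutoff_bounds:
  fixes x :: "'a::euclidean_space"
  assumes N: "N \<ge> 1"
  shows "\<bar>cutoff N x\<bar> \<le> 1" "\<bar>pd v (cutoff N) x\<bar> \<le> 4 * norm v / N" "norm x > N \<Longrightarrow> cutoff N x = 0"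
proof -
  have m: "0 \<le> max 0 (1 - (x \<bullet> x) / N\<^sup>2)" "max 0 (1 - (x \<bullet> x) / N\<^sup>2) \<le> 1"
    by auto
  show "\<bar>cutoff N x\<bar> \<le> 1"
    unfolding cutoff_def using m by (simp add: power_le_one)
  have z: "max 0 (1 - (x \<bullet> x) / N\<^sup>2) = 0" if "norm x > N"
  proof -
    have "N\<^sup>2 \<le> (norm x)\<^sup>2" using that N by (intro power_mono) auto
    then show ?thesis using N by (simp add: dot_square_norm field_simps)
  qed
  then show "norm x > N \<Longrightarrow> cutoff N x = 0"
    by (simp add: cutoff_def)
  have pd: "pd v (cutoff N) x = 2 * max 0 (1 - (x \<bullet> x) / N\<^sup>2) * (- 2 * (x \<bullet> v) / N\<^sup>2)"
    by (rule pd_eqI[OF cutoff_has_derivative])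
  show "\<bar>pd v (cutoff N) x\<bar> \<le> 4 * norm v / N"
  proof (cases "norm x > N")
    case True
    then show ?thesis using N unfolding pd z[OF True] by simp
  next
    case False
    have "\<bar>x \<bullet> v\<bar> \<le> N * norm v"
      using Cauchy_Schwarz_ineq2[of x v] False by (meson mult_right_mono norm_ge_zero not_less order_trans)
    have "\<bar>pd v (cutoff N) x\<bar> = max 0 (1 - (x \<bullet> x) / N\<^sup>2) * (4 * \<bar>x \<bullet> v\<bar> / N\<^sup>2)"
      unfolding pd using m by (simp add: abs_mult)
    also have "\<dots> \<le> 1 * (4 * (N * norm v) / N\<^sup>2)"
      using m \<open>\<bar>x \<bullet> v\<bar> \<le> N * norm v\<close> by (intro mult_mono divide_right_mono) auto
    also have "\<dots> = 4 * norm v / N"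
      using N by (simp add: power2_eq_square)
    finally show ?thesis .
  qed
qed

lemma cutoff_tendsto: "(\<lambda>k. cutoff (real (Suc k)) x) \<longlonglongrightarrow> 1"
proof -
  have "(\<lambda>k. 1 - (x \<bullet> x) * (1 / real (Suc k))\<^sup>2) \<longlonglongrightarrow> 1 - (x \<bullet> x) * 0\<^sup>2"
    by (intro tendsto_intros lim_1_over_n[THEN LIMSEQ_Suc])
  then have "(\<lambda>k. (max 0 (1 - (x \<bullet> x) / (real (Suc k))\<^sup>2))\<^sup>2) \<longlonglongrightarrow> (max 0 1)\<^sup>2"
    by (intro tendsto_intros) (simp add: power_divide)
  then show ?thesis by (simp add: cutoff_def)
qed

text \<open>
  Only the divergence is assumed integrable, not the individual partial derivatives, which may
  contain derivatives that cancel in the sum.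
\<close>

theorem integral_divergence_eq_0:
  fixes W :: "'i \<Rightarrow> 'a::euclidean_space \<Rightarrow> real"
  assumes W: "\<And>i. i \<in> I \<Longrightarrow> Ck (Suc 0) (W i)" "\<And>i. i \<in> I \<Longrightarrow> integrable lborel (W i)"
    and div: "integrable lborel (\<lambda>x. \<Sum>i\<in>I. pd (v i) (W i) x)"
  shows "(\<integral>x. (\<Sum>i\<in>I. pd (v i) (W i) x) \<partial>lborel) = 0"
proof -
  define \<eta> where "\<eta> k = (cutoff (real (Suc k)) :: 'a \<Rightarrow> real)" for k :: nat
  \<comment> \<open>The divergence of the cut-off field, with the derivatives of \<open>W\<close>
    kept in a single sum: the sum is dominated by the integrable divergence, while its terms taken
    separately need not be integrable.\<close>
  define F where "F k x = \<eta> k x * (\<Sum>i\<in>I. pd (v i) (W i) x) + (\<Sum>i\<in>I. pd (v i) (\<eta> k) x * W i x)" for k x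
  have \<eta>1: "Ck (Suc 0) (\<eta> k)" for k
    unfolding \<eta>_def by (rule Ck_cutoff)
  have [measurable]: "pd (v i) (W i) \<in> borel_measurable borel" "W i \<in> borel_measurable borel" if "i \<in> I" for i
    by (rule Ck_measurable[OF Ck_Suc_pd[OF W(1)[OF that]]], rule Ck_measurable[OF W(1)[OF that]])
  have [measurable]: "\<eta> k \<in> borel_measurable borel" "pd v (\<eta> k) \<in> borel_measurable borel" for k v
    by (rule Ck_measurable[OF \<eta>1], rule Ck_measurable[OF Ck_Suc_pd[OF \<eta>1]])
  have F0: "(\<integral>x. F k x \<partial>lborel) = 0" for k
  proof -
    have C: "Ck (Suc 0) (\<lambda>x. \<eta> k x * W i x)" if "i \<in> I" for i
      by (intro Ck_intros \<eta>1 W that)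
    have S: "\<eta> k x * W i x = 0" if "norm x > real (Suc k)" for i x
      using cutoff_bounds(3)[of "real (Suc k)" x] that by (simp add: \<eta>_def)
    have "F k x = (\<Sum>i\<in>I. pd (v i) (\<lambda>x. \<eta> k x * W i x) x)" for x
    proof -
      have "pd (v i) (\<lambda>x. \<eta> k x * W i x) x = \<eta> k x * pd (v i) (W i) x + pd (v i) (\<eta> k) x * W i x"
        if "i \<in> I" for i
        using \<eta>1 W(1)[OF that] by (intro pd_mult) auto
      then show ?thesis
        by (simp add: F_def sum.distrib sum_distrib_left)
    qed
    then have "(\<integral>x. F k x \<partial>lborel) = (\<Sum>i\<in>I. \<integral>x. pd (v i) (\<lambda>x. \<eta> k x * W i x) x \<partial>lborel)"
      using integral_pd_compact_support(1)[OF C S] by (simp add: Bochner_Integration.integral_sum)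
    also have "\<dots> = 0"
      using integral_pd_compact_support(2)[OF C S] by simp
    finally show ?thesis .
  qed
  have "(\<lambda>k. \<integral>x. F k x \<partial>lborel) \<longlonglongrightarrow> (\<integral>x. (\<Sum>i\<in>I. pd (v i) (W i) x) \<partial>lborel)"
  proof (rule integral_dominated_convergence[where
        w = "\<lambda>x. norm (\<Sum>i\<in>I. pd (v i) (W i) x) + (\<Sum>i\<in>I. 4 * norm (v i) * norm (W i x))"])
    show "integrable lborel (\<lambda>x. norm (\<Sum>i\<in>I. pd (v i) (W i) x) + (\<Sum>i\<in>I. 4 * norm (v i) * norm (W i x)))"
      by (intro Bochner_Integration.integrable_add Bochner_Integration.integrable_sum
          integrable_mult_right Bochner_Integration.integrable_norm div W)
    show "AE x in lborel. (\<lambda>k. F k x) \<longlonglongrightarrow> (\<Sum>i\<in>I. pd (v i) (W i) x)"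
    proof (intro AE_I2)
      fix x
      have "(\<lambda>k. pd (v i) (\<eta> k) x) \<longlonglongrightarrow> 0" for i
      proof (rule Lim_null_comparison)
        show "\<forall>\<^sub>F k in sequentially. norm (pd (v i) (\<eta> k) x) \<le> 4 * norm (v i) * (1 / real (Suc k))"
          using cutoff_bounds(2)[where N = "real (Suc k)" and v = "v i" and x = x for k]
          by (intro always_eventually) (auto simp: \<eta>_def)
        show "(\<lambda>k. 4 * norm (v i) * (1 / real (Suc k))) \<longlonglongrightarrow> 0"
          by (intro tendsto_mult_right_zero lim_1_over_n[THEN LIMSEQ_Suc])
      qed
      moreover have "(\<lambda>k. \<eta> k x) \<longlonglongrightarrow> 1"
        unfolding \<eta>_def by (rule cutoff_tendsto)
      ultimately have "(\<lambda>k. F k x) \<longlonglongrightarrow> 1 * (\<Sum>i\<in>I. pd (v i) (W i) x) + (\<Sum>i\<in>I. 0 * W i x)"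
        unfolding F_def by (intro tendsto_intros)
      then show "(\<lambda>k. F k x) \<longlonglongrightarrow> (\<Sum>i\<in>I. pd (v i) (W i) x)" by simp
    qed
    show "AE x in lborel. norm (F k x) \<le> norm (\<Sum>i\<in>I. pd (v i) (W i) x) + (\<Sum>i\<in>I. 4 * norm (v i) * norm (W i x))" for k
    proof (intro AE_I2)
      fix x
      have "\<bar>pd (v i) (\<eta> k) x\<bar> \<le> 4 * norm (v i)" for i
      proof -
        have "4 * norm (v i) / real (Suc k) \<le> 4 * norm (v i)"
          by (simp add: divide_le_eq mult_le_cancel_left1)
        with cutoff_bounds(2)[where N = "real (Suc k)" and v = "v i" and x = x] show ?thesis
          by (simp add: \<eta>_def)
      qed
      then have "norm (\<Sum>i\<in>I. pd (v i) (\<eta> k) x * W i x) \<le> (\<Sum>i\<in>I. 4 * norm (v i) * norm (W i x))"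
        by (intro sum_norm_le) (auto simp: abs_mult intro!: mult_right_mono)
      moreover have "norm (\<eta> k x * (\<Sum>i\<in>I. pd (v i) (W i) x)) \<le> norm (\<Sum>i\<in>I. pd (v i) (W i) x)"
        using cutoff_bounds(1)[of "real (Suc k)" x]
        by (simp add: \<eta>_def abs_mult mult_left_le_one_le)
      ultimately show "norm (F k x) \<le> norm (\<Sum>i\<in>I. pd (v i) (W i) x) + (\<Sum>i\<in>I. 4 * norm (v i) * norm (W i x))"
        unfolding F_def using norm_triangle_le by (meson add_mono norm_triangle_ineq order_trans)
    qed
    show "(\<lambda>x. \<Sum>i\<in>I. pd (v i) (W i) x) \<in> borel_measurable lborel" "F k \<in> borel_measurable lborel" for k
      unfolding F_def[abs_def] by measurable
  qed
  then show ?thesis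
    unfolding F0 by (simp add: LIMSEQ_const_iff)
qed

section \<open>Bounded and square-integrable functions\<close>

text \<open>The bound is asked for almost everywhere because boundedness of the gradient is derived
  from its law.\<close>

definition ess_bounded :: "'a measure \<Rightarrow> ('a \<Rightarrow> real) \<Rightarrow> bool" where
  "ess_bounded M f \<longleftrightarrow> f \<in> borel_measurable M \<and> (\<exists>K. AE x in M. \<bar>f x\<bar> \<le> K)"

definition square_integrable :: "'a measure \<Rightarrow> ('a \<Rightarrow> real) \<Rightarrow> bool" where
  "square_integrable M f \<longleftrightarrow> f \<in> borel_measurable M \<and> integrable M (\<lambda>x. (f x)\<^sup>2)"

lemma ess_bounded_const: "ess_bounded M (\<lambda>x. c)"
  by (auto simp: ess_bounded_def)

lemma ess_bounded_add:
  assumes "ess_bounded M f" "ess_bounded M g"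
  shows "ess_bounded M (\<lambda>x. f x + g x)"
proof -
  obtain K L where "AE x in M. \<bar>f x\<bar> \<le> K" "AE x in M. \<bar>g x\<bar> \<le> L"
    using assms by (auto simp: ess_bounded_def)
  then have "AE x in M. \<bar>f x + g x\<bar> \<le> K + L" by eventually_elim auto
  with assms show ?thesis by (auto simp: ess_bounded_def)
qed

lemma ess_bounded_mult:
  assumes "ess_bounded M f" "ess_bounded M g"
  shows "ess_bounded M (\<lambda>x. f x * g x)"
proof -
  obtain K L where "AE x in M. \<bar>f x\<bar> \<le> K" "AE x in M. \<bar>g x\<bar> \<le> L"
    using assms by (auto simp: ess_bounded_def)
  then have "AE x in M. \<bar>f x * g x\<bar> \<le> K * L"
    by eventually_elim (auto simp: abs_mult intro!: mult_mono)
  with assms show ?thesis by (auto simp: ess_bounded_def)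
qed

lemma ess_bounded_sum:
  "(\<And>i. i \<in> I \<Longrightarrow> ess_bounded M (f i)) \<Longrightarrow> ess_bounded M (\<lambda>x. \<Sum>i\<in>I. f i x)"
  by (induction I rule: infinite_finite_induct) (auto intro: ess_bounded_add ess_bounded_const)

lemma integrable_ess_bounded_mult:
  assumes f: "ess_bounded M f" and g: "integrable M g"
  shows "integrable M (\<lambda>x. f x * g x)"
proof -
  obtain K where K: "AE x in M. \<bar>f x\<bar> \<le> K" and [measurable]: "f \<in> borel_measurable M"
    using f by (auto simp: ess_bounded_def)
  have [measurable]: "g \<in> borel_measurable M"
    using g by auto
  show ?thesis
  proof (rule Bochner_Integration.integrable_bound[of M "\<lambda>x. K * g x"])
    show "AE x in M. norm (f x * g x) \<le> norm (K * g x)"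
      using K by eventually_elim (auto simp: abs_mult intro!: mult_right_mono)
  qed (use g in auto)
qed

lemma square_integrable_mult:
  assumes "square_integrable M f" "square_integrable M g"
  shows "integrable M (\<lambda>x. f x * g x)"
proof (rule Bochner_Integration.integrable_bound[of M "\<lambda>x. (f x)\<^sup>2 + (g x)\<^sup>2"])
  have "\<bar>a * b\<bar> \<le> a\<^sup>2 + b\<^sup>2" for a b :: real
  proof -
    have "2 * \<bar>a * b\<bar> \<le> a\<^sup>2 + b\<^sup>2"
      using sum_squares_bound[of "\<bar>a\<bar>" "\<bar>b\<bar>"] by (simp add: abs_mult)
    then show ?thesis using abs_ge_zero[of "a * b"] by linarith
  qed
  then show "AE x in M. norm (f x * g x) \<le> norm ((f x)\<^sup>2 + (g x)\<^sup>2)"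
    by (intro AE_I2) simp
qed (use assms in \<open>auto simp: square_integrable_def\<close>)

lemma square_integrable_add:
  assumes "square_integrable M f" "square_integrable M g"
  shows "square_integrable M (\<lambda>x. f x + g x)"
  using assms square_integrable_mult[OF assms]
  by (auto simp: square_integrable_def power2_sum mult.assoc)

lemma square_integrable_zero: "square_integrable M (\<lambda>x. 0)"
  by (simp add: square_integrable_def)

lemma square_integrable_sum:
  "(\<And>i. i \<in> I \<Longrightarrow> square_integrable M (f i)) \<Longrightarrow> square_integrable M (\<lambda>x. \<Sum>i\<in>I. f i x)"
  by (induction I rule: infinite_finite_induct) (auto intro: square_integrable_add square_integrable_zero)

lemma square_integrable_ess_bounded_mult:
  assumes f: "ess_bounded M f" and g: "square_integrable M g"
  shows "square_integrable M (\<lambda>x. f x * g x)"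
  using integrable_ess_bounded_mult[OF ess_bounded_mult[OF f f], of "\<lambda>x. (g x)\<^sup>2"] assms
  by (auto simp: square_integrable_def ess_bounded_def power2_eq_square ac_simps)

lemma (in finite_measure) ess_bounded_imp_square_integrable:
  "ess_bounded M f \<Longrightarrow> square_integrable M f"
  using integrable_ess_bounded_mult[OF ess_bounded_mult, of M f f "\<lambda>x. 1"]
  by (simp add: square_integrable_def ess_bounded_def power2_eq_square)

lemma (in finite_measure) square_integrable_imp_integrable:
  "square_integrable M f \<Longrightarrow> integrable M f"
  using square_integrable_mult[OF _ ess_bounded_imp_square_integrable[OF ess_bounded_const[of M 1]], of f]
  by simp

section \<open>Moment potentials\<close>

text \<open>The integral identities see the target only through its bounded support, recorded here
  as an almost sure bound on the gradient. Convexity provides the positivity of the Hessian for the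
  variance inequality.\<close>

locale bounded_gradient_potential =
  fixes \<psi> :: "real^'n \<Rightarrow> real"
  assumes smooth: "\<And>k. Ck k \<psi>"
    and convex: "convex_on UNIV \<psi>"
    and total: "(\<integral>u. exp (- \<psi> u) \<partial>lborel) = 1"
    and bounded_grad: "\<exists>K. AE u in moment_law \<psi>. norm (grad \<psi> u) \<le> K"
begin

abbreviation \<nu> :: "(real^'n) measure" where "\<nu> \<equiv> moment_law \<psi>"

abbreviation y :: "'n \<Rightarrow> real^'n \<Rightarrow> real" where "y i \<equiv> pd (axis i 1) \<psi>"

abbreviation h :: "'n \<Rightarrow> 'n \<Rightarrow> real^'n \<Rightarrow> real" where "h i j \<equiv> pd (axis j 1) (y i)"

lemma Ck_pd: "Ck k (pd v \<psi>)" "Ck k (pd w (pd v \<psi>))"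
  by (rule Ck_Suc_pd[OF smooth], rule Ck_Suc_pd[OF Ck_Suc_pd[OF smooth]])

lemma grad_nth: "grad \<psi> x $ i = y i x"
  by (simp add: grad_def)

lemma grad_has_derivative: "(grad \<psi> has_derivative (\<lambda>w. hessian \<psi> x *v w)) (at x)"
proof -
  have "grad \<psi> differentiable (at x)"
  proof (subst differentiable_componentwise_within, rule ballI)
    fix b :: "real^'n" assume "b \<in> Basis"
    then obtain i where "b = axis i 1"
      by (auto simp: Basis_vec_def)
    then have "(\<lambda>x. grad \<psi> x \<bullet> b) = y i"
      by (auto simp: inner_axis grad_nth)
    then show "(\<lambda>x. grad \<psi> x \<bullet> b) differentiable at x"
      using Ck_Suc_has_derivative[OF Ck_pd(1)] by (auto simp: differentiable_def)
  qed
  then show ?thesis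
    unfolding hessian_def by (simp add: jacobian_works)
qed

lemma hessian_nth: "hessian \<psi> x $ i $ j = h i j x"
proof -
  have "((\<lambda>x. grad \<psi> x $ i) has_derivative (\<lambda>w. (hessian \<psi> x *v w) $ i)) (at x)"
    by (rule bounded_linear.has_derivative[OF bounded_linear_vec_nth grad_has_derivative])
  then have "pd (axis j 1) (\<lambda>x. grad \<psi> x $ i) x = (hessian \<psi> x *v axis j 1) $ i"
    by (rule pd_eqI)
  then show ?thesis
    by (simp add: grad_nth matrix_vector_mult_basis column_def)
qed

lemma h_sym: "h i j x = h j i x"
  by (rule pd_commute[OF smooth])

lemma hessian_Sym: "transpose (hessian \<psi> x) = hessian \<psi> x"
  using h_sym by (auto simp: vec_eq_iff transpose_def hessian_nth)

lemma pd_eq_inner_grad: "pd v \<psi> x = grad \<psi> x \<bullet> v"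
proof -
  have "linear (\<lambda>v. pd v \<psi> x)"
    using has_derivative_linear[OF Ck_Suc_has_derivative[OF smooth]] .
  then have "pd (\<Sum>i\<in>UNIV. v $ i *s axis i 1) \<psi> x = (\<Sum>i\<in>UNIV. v $ i * y i x)"
    by (simp add: linear_sum scalar_mult_eq_scaleR linear_scale)
  then show ?thesis
    by (simp add: basis_expansion inner_vec_def grad_nth mult.commute)
qed

lemma pd_pd_eq: "pd w (pd v \<psi>) x = (hessian \<psi> x *v w) \<bullet> v"
proof -
  have "((\<lambda>x. grad \<psi> x \<bullet> v) has_derivative (\<lambda>w. (hessian \<psi> x *v w) \<bullet> v)) (at x)"
    by (rule bounded_linear.has_derivative[OF bounded_linear_inner_left grad_has_derivative])
  then show ?thesis
    unfolding pd_eq_inner_grad by (rule pd_eqI)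
qed

text \<open>A negative second derivative along \<open>w\<close> would make the slope along that line
  drop just to the right of 0, whereas the tangent inequalities at 0 and at \<open>d / 2\<close>,
  added together, keep the slope from decreasing.\<close>

lemma hessian_nonneg: "0 \<le> (hessian \<psi> x *v w) \<bullet> w"
proof (rule ccontr)
  assume "\<not> 0 \<le> (hessian \<psi> x *v w) \<bullet> w"
  then have neg: "pd w (pd w \<psi>) x < 0"
    by (simp add: pd_pd_eq)
  define f where "f t = \<psi> (x + t *\<^sub>R w)" for t
  define f' where "f' t = pd w \<psi> (x + t *\<^sub>R w)" for t
  have f: "(f has_real_derivative f' t) (at t)" for t
    unfolding f_def[abs_def] f'_def by (rule line_has_real_derivative[OF smooth])
  have f': "(f' has_real_derivative pd w (pd w \<psi>) x) (at 0)"
    using line_has_real_derivative[OF Ck_pd(1)[where v = w], where e = w and y = x and t = 0] by (simp add: f'_def[abs_def])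
  have "convex_on UNIV f"
  proof (rule convex_onI)
    fix t a b :: real assume t: "0 < t" "t < 1"
    have "x + ((1 - t) *\<^sub>R a + t *\<^sub>R b) *\<^sub>R w = (1 - t) *\<^sub>R (x + a *\<^sub>R w) + t *\<^sub>R (x + b *\<^sub>R w)"
      by (simp add: algebra_simps)
    then show "f ((1 - t) *\<^sub>R a + t *\<^sub>R b) \<le> (1 - t) * f a + t * f b"
      unfolding f_def using convex_onD[OF convex, of t "x + a *\<^sub>R w" "x + b *\<^sub>R w"] t by simp
  qed simp
  then have tangent: "f' c * (z - c) \<le> f z - f c" for z c
    using convex_on_imp_above_tangent[of UNIV f c z "f' c"] f by auto
  obtain d where d: "d > 0" "\<And>t. 0 < t \<Longrightarrow> t < d \<Longrightarrow> f' (0 + t) < f' 0"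
    using DERIV_neg_dec_right[OF f' neg] by blast
  have "f' (d / 2) < f' 0" using d(2)[of "d / 2"] d(1) by simp
  moreover have "f' 0 * (d / 2) \<le> f' (d / 2) * (d / 2)"
    using tangent[of 0 "d / 2"] tangent[of "d / 2" 0] by (simp add: algebra_simps)
  ultimately show False using d(1) by (simp add: mult_le_cancel_right)
qed

text \<open>A non-integrable function would have Bochner integral 0, contrary to
  \<open>total\<close>.\<close>

lemma exp_integrable: "integrable lborel (\<lambda>u. exp (- \<psi> u))"
  by (rule ccontr) (use total in \<open>simp add: not_integrable_integral_eq\<close>)

lemma [measurable]: "\<psi> \<in> borel_measurable borel"
  by (rule Ck_measurable[OF smooth])

lemma pd_measurable [measurable]:
  "pd v \<psi> \<in> borel_measurable borel" "pd w (pd v \<psi>) \<in> borel_measurable borel"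
  by (rule Ck_measurable[OF Ck_pd(1)], rule Ck_measurable[OF Ck_pd(2)])

lemma sets_\<nu> [simp, measurable_cong]: "sets \<nu> = sets borel" and space_\<nu> [simp]: "space \<nu> = UNIV"
  by (simp_all add: moment_law_def)

sublocale prob_space \<nu>
proof
  have "emeasure \<nu> (space \<nu>) = (\<integral>\<^sup>+u. ennreal (exp (- \<psi> u)) \<partial>lborel)"
    by (simp add: moment_law_def emeasure_density)
  also have "\<dots> = 1"
    using total exp_integrable by (simp add: nn_integral_eq_integral)
  finally show "emeasure \<nu> (space \<nu>) = 1" .
qed

lemma integral_\<nu>: "f \<in> borel_measurable borel \<Longrightarrow> (\<integral>x. f x \<partial>\<nu>) = (\<integral>x. f x * exp (- \<psi> x) \<partial>lborel)" for f :: "_ \<Rightarrow> real"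
  by (simp add: moment_law_def integral_density mult.commute)

lemma integrable_\<nu>: "f \<in> borel_measurable borel \<Longrightarrow> integrable \<nu> f \<longleftrightarrow> integrable lborel (\<lambda>x. f x * exp (- \<psi> x))" for f :: "_ \<Rightarrow> real"
  by (simp add: moment_law_def integrable_density mult.commute)

lemma y_bounded: "ess_bounded \<nu> (y i)"
proof -
  obtain K where "AE u in \<nu>. norm (grad \<psi> u) \<le> K" using bounded_grad by blast
  then have "AE u in \<nu>. \<bar>y i u\<bar> \<le> K"
    by eventually_elim (metis component_le_norm_cart grad_nth order_trans)
  then show ?thesis by (auto simp: ess_bounded_def)
qed

end

section \<open>The integrands as polynomials in the first and second derivatives of the
  potential\<close>

context bounded_gradient_potential
begin

text \<open>The quantities from here on are coordinate sums, so that regularity, boundedness and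
  integrability follow termwise from those of \<open>y\<close> and \<open>h\<close>. The lemmas
  ending in \<open>_eq\<close> return to matrix notation; \<open>mgrad\<close> is the vector
  AY.\<close>

definition mgrad :: "real^'n^'n \<Rightarrow> 'n \<Rightarrow> real^'n \<Rightarrow> real" where
  "mgrad A k x = (\<Sum>l\<in>UNIV. A $ k $ l * y l x)"

definition quad_grad :: "real^'n^'n \<Rightarrow> real^'n \<Rightarrow> real" where
  "quad_grad A x = (\<Sum>k\<in>UNIV. y k x * mgrad A k x)"

definition trace_hess :: "real^'n^'n \<Rightarrow> real^'n \<Rightarrow> real" where
  "trace_hess A x = (\<Sum>i\<in>UNIV. \<Sum>k\<in>UNIV. A $ i $ k * h k i x)"

definition hess_form :: "real^'n^'n \<Rightarrow> real^'n^'n \<Rightarrow> real^'n \<Rightarrow> real" where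
  "hess_form A B x = (\<Sum>k\<in>UNIV. \<Sum>l\<in>UNIV. mgrad A k x * (h k l x * mgrad B l x))"

text \<open>The order is that of Tr(BHAH), the shape in which this sum comes out of the divergence
  of BHAY.\<close>

definition trace_hess_sq :: "real^'n^'n \<Rightarrow> real^'n^'n \<Rightarrow> real^'n \<Rightarrow> real" where
  "trace_hess_sq A B x = (\<Sum>i\<in>UNIV. \<Sum>k\<in>UNIV. \<Sum>l\<in>UNIV. \<Sum>r\<in>UNIV. B $ i $ k * (h k l x * (A $ l $ r * h r i x)))"

text \<open>Component \<open>i\<close> of the vector BHAY, the last summand of the field.\<close>

definition hess_mgrad :: "real^'n^'n \<Rightarrow> real^'n^'n \<Rightarrow> 'n \<Rightarrow> real^'n \<Rightarrow> real" where
  "hess_mgrad A B i x = (\<Sum>k\<in>UNIV. \<Sum>l\<in>UNIV. B $ i $ k * (h k l x * mgrad A l x))"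

lemma mgrad_eq: "mgrad A k x = (A *v grad \<psi> x) $ k"
  by (simp add: mgrad_def matrix_vector_mult_def grad_nth)

lemma quad_grad_eq: "quad_grad A x = grad \<psi> x \<bullet> (A *v grad \<psi> x)"
  by (simp add: quad_grad_def mgrad_eq inner_vec_def grad_nth)

lemma trace_hess_eq: "trace_hess A x = trace (A ** hessian \<psi> x)"
  by (simp add: trace_hess_def trace_def matrix_matrix_mult_def hessian_nth)

lemma hess_form_eq: "hess_form A B x = (A *v grad \<psi> x) \<bullet> (hessian \<psi> x *v (B *v grad \<psi> x))"
  by (simp add: hess_form_def mgrad_eq inner_vec_def matrix_vector_mult_def[of "hessian \<psi> x"] hessian_nth
      sum_distrib_left)

lemma trace_hess_sq_eq: "trace_hess_sq A B x = trace (B ** hessian \<psi> x ** A ** hessian \<psi> x)"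
  unfolding matrix_mul_assoc[symmetric]
  by (simp add: trace_hess_sq_def trace_def matrix_matrix_mult_def hessian_nth sum_distrib_left)

lemma Ck_forms: "Ck k (mgrad A i)" "Ck k (quad_grad A)" "Ck k (trace_hess A)" "Ck k (hess_form A B)" "Ck k (hess_mgrad A B i)" "Ck k (trace_hess_sq A B)"
proof -
  have *: "Ck k (mgrad A i)" for A i
    unfolding mgrad_def[abs_def] by (intro Ck_intros Ck_pd)
  then show "Ck k (mgrad A i)" .
  show "Ck k (quad_grad A)" "Ck k (trace_hess A)" "Ck k (hess_form A B)" "Ck k (hess_mgrad A B i)" "Ck k (trace_hess_sq A B)"
    unfolding quad_grad_def[abs_def] trace_hess_def[abs_def] hess_form_def[abs_def] hess_mgrad_def[abs_def] trace_hess_sq_def[abs_def]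
    by (intro Ck_intros Ck_pd *)+
qed

lemma forms_measurable [measurable]:
  "mgrad A i \<in> borel_measurable borel" "quad_grad A \<in> borel_measurable borel" "trace_hess A \<in> borel_measurable borel"
  "hess_form A B \<in> borel_measurable borel" "hess_mgrad A B i \<in> borel_measurable borel" "trace_hess_sq A B \<in> borel_measurable borel"
  by (rule Ck_measurable[OF Ck_forms(1)] Ck_measurable[OF Ck_forms(2)] Ck_measurable[OF Ck_forms(3)]
      Ck_measurable[OF Ck_forms(4)] Ck_measurable[OF Ck_forms(5)] Ck_measurable[OF Ck_forms(6)])+

lemma differentiable_forms:
  "y i differentiable (at x)" "h i j differentiable (at x)" "\<psi> differentiable (at x)"
  "mgrad A i differentiable (at x)" "quad_grad A differentiable (at x)" "trace_hess A differentiable (at x)"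
  "hess_mgrad A B i differentiable (at x)"
  using Ck_Suc_has_derivative[OF Ck_pd(1)] Ck_Suc_has_derivative[OF Ck_pd(2)]
    Ck_Suc_has_derivative[OF smooth] Ck_Suc_has_derivative[OF Ck_forms(1)]
    Ck_Suc_has_derivative[OF Ck_forms(2)] Ck_Suc_has_derivative[OF Ck_forms(3)]
    Ck_Suc_has_derivative[OF Ck_forms(5)]
  unfolding differentiable_def by blast+

lemma mgrad_bounded: "ess_bounded \<nu> (mgrad A i)"
  unfolding mgrad_def[abs_def] by (intro ess_bounded_sum ess_bounded_mult ess_bounded_const y_bounded)

lemma quad_grad_bounded: "ess_bounded \<nu> (quad_grad A)"
  unfolding quad_grad_def[abs_def] by (intro ess_bounded_sum ess_bounded_mult mgrad_bounded y_bounded)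

lemma pd_mgrad: "pd (axis m 1) (mgrad A k) x = (\<Sum>l\<in>UNIV. A $ k $ l * h l m x)"
proof -
  have "pd (axis m 1) (mgrad A k) x = (\<Sum>l\<in>UNIV. pd (axis m 1) (\<lambda>x. A $ k $ l * y l x) x)"
    unfolding mgrad_def[abs_def] by (intro pd_sum differentiable_mult differentiable_const differentiable_forms)
  then show ?thesis
    by (simp add: pd_cmult[OF differentiable_forms(1)])
qed

lemma pd_trace_hess: "pd (axis m 1) (trace_hess A) x = (\<Sum>i\<in>UNIV. \<Sum>k\<in>UNIV. A $ i $ k * pd (axis m 1) (h k i) x)"
proof -
  have "pd (axis m 1) (trace_hess A) x = (\<Sum>i\<in>UNIV. pd (axis m 1) (\<lambda>x. \<Sum>k\<in>UNIV. A $ i $ k * h k i x) x)"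
    unfolding trace_hess_def[abs_def]
    by (intro pd_sum differentiable_sum differentiable_mult differentiable_const differentiable_forms finite ballI)
  also have "\<dots> = (\<Sum>i\<in>UNIV. \<Sum>k\<in>UNIV. pd (axis m 1) (\<lambda>x. A $ i $ k * h k i x) x)"
    by (intro sum.cong refl pd_sum differentiable_mult differentiable_const differentiable_forms)
  finally show ?thesis
    by (simp add: pd_cmult[OF differentiable_forms(2)])
qed

lemma pd_hess_mgrad: "pd (axis m 1) (hess_mgrad A B i) x = (\<Sum>k\<in>UNIV. \<Sum>l\<in>UNIV. B $ i $ k *
    (h k l x * (\<Sum>r\<in>UNIV. A $ l $ r * h r m x) + pd (axis m 1) (h k l) x * mgrad A l x))"
proof -
  have "pd (axis m 1) (hess_mgrad A B i) x =
     (\<Sum>k\<in>UNIV. pd (axis m 1) (\<lambda>x. \<Sum>l\<in>UNIV. B $ i $ k * (h k l x * mgrad A l x)) x)"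
    unfolding hess_mgrad_def[abs_def]
    by (intro pd_sum differentiable_sum differentiable_mult differentiable_const differentiable_forms finite ballI)
  also have "\<dots> = (\<Sum>k\<in>UNIV. \<Sum>l\<in>UNIV. pd (axis m 1) (\<lambda>x. B $ i $ k * (h k l x * mgrad A l x)) x)"
    by (intro sum.cong refl pd_sum differentiable_mult differentiable_const differentiable_forms)
  also have "\<dots> = (\<Sum>k\<in>UNIV. \<Sum>l\<in>UNIV. B $ i $ k * pd (axis m 1) (\<lambda>x. h k l x * mgrad A l x) x)"
    by (intro sum.cong refl pd_cmult differentiable_mult differentiable_const differentiable_forms)
  also have "\<dots> = (\<Sum>k\<in>UNIV. \<Sum>l\<in>UNIV. B $ i $ k *
     (h k l x * pd (axis m 1) (mgrad A l) x + pd (axis m 1) (h k l) x * mgrad A l x))"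
    by (simp add: pd_mult[OF differentiable_forms(2,4)])
  finally show ?thesis
    by (simp add: pd_mgrad)
qed

text \<open>Symmetry of \<open>A\<close> merges the two product-rule terms. As H is symmetric too,
  the gradient of Y \<bullet> AY is 2HAY, which lies in the range of H.\<close>

lemma pd_quad_grad:
  assumes A: "transpose A = A"
  shows "pd w (quad_grad A) x = 2 * ((hessian \<psi> x *v w) \<bullet> (A *v grad \<psi> x))"
proof -
  let ?H = "hessian \<psi> x"
  have "((\<lambda>x. A *v grad \<psi> x) has_derivative (\<lambda>w. A *v (?H *v w))) (at x)"
    by (rule bounded_linear.has_derivative[OF matrix_vector_mul_bounded_linear grad_has_derivative])
  then have "((\<lambda>x. grad \<psi> x \<bullet> (A *v grad \<psi> x)) has_derivative
      (\<lambda>w. grad \<psi> x \<bullet> (A *v (?H *v w)) + (?H *v w) \<bullet> (A *v grad \<psi> x))) (at x)"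
    by (rule has_derivative_inner[OF grad_has_derivative])
  then have "pd w (quad_grad A) x = grad \<psi> x \<bullet> (A *v (?H *v w)) + (?H *v w) \<bullet> (A *v grad \<psi> x)"
    unfolding quad_grad_eq[abs_def] by (rule pd_eqI)
  moreover have "grad \<psi> x \<bullet> (A *v (?H *v w)) = (?H *v w) \<bullet> (A *v grad \<psi> x)"
    using dot_lmul_matrix[of "grad \<psi> x" A "?H *v w"] A transpose_matrix_vector[of A "grad \<psi> x"]
    by (simp add: inner_commute)
  ultimately show ?thesis by simp
qed

lemma pd_quad_grad_axis:
  assumes A: "transpose A = A"
  shows "pd (axis m 1) (quad_grad A) x = 2 * (\<Sum>k\<in>UNIV. h k m x * mgrad A k x)"
  unfolding pd_quad_grad[OF A] by (simp add: inner_vec_def matrix_vector_mult_basis column_def hessian_nth mgrad_eq)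

text \<open>With X for the third-derivative term, Tr(BH) AY contributes Tr(AH) Tr(BH) + X - (Y
  \<bullet> AY) Tr(BH), and (Y \<bullet> AY) BY contributes (Y \<bullet> AY) Tr(BH) + 2 BY \<bullet>
  HAY - (Y \<bullet> AY)(Y \<bullet> BY). Subtracting BHAY takes away X + Tr(BHAH) - BY \<bullet>
  HAY. The factor 3 is thus 2 from the gradient of Y \<bullet> AY plus 1 from Y \<bullet>
  BHAY.\<close>

lemma divergence_identity:
  assumes A: "transpose A = A" and B: "transpose B = B"
  defines "Z \<equiv> \<lambda>i x. trace_hess B x * mgrad A i x + quad_grad A x * mgrad B i x - hess_mgrad A B i x"
  shows "(\<Sum>i\<in>UNIV. pd (axis i 1) (Z i) x - y i x * Z i x) =
    trace_hess A x * trace_hess B x + 3 * hess_form B A x - quad_grad A x * quad_grad B x - trace_hess_sq A B x"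
proof -
  define h3 where "h3 i j k = pd (axis k 1) (h i j) x" for i j k
  have h3: "h3 i j k = h3 i k j" for i j k
    unfolding h3_def by (rule pd_commute[OF Ck_pd(1)])
  have B': "B $ i $ k = B $ k $ i" for i k
    using B by (metis transpose_def vec_lambda_beta)
  have Z: "pd (axis i 1) (Z i) x = (trace_hess B x * pd (axis i 1) (mgrad A i) x + pd (axis i 1) (trace_hess B) x * mgrad A i x)
     + (quad_grad A x * pd (axis i 1) (mgrad B i) x + pd (axis i 1) (quad_grad A) x * mgrad B i x) - pd (axis i 1) (hess_mgrad A B i) x" for i
  proof -
    have "pd (axis i 1) (Z i) x =
       pd (axis i 1) (\<lambda>x. trace_hess B x * mgrad A i x + quad_grad A x * mgrad B i x) x - pd (axis i 1) (hess_mgrad A B i) x"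
      unfolding Z_def by (intro pd_diff differentiable_add differentiable_mult differentiable_forms)
    also have "pd (axis i 1) (\<lambda>x. trace_hess B x * mgrad A i x + quad_grad A x * mgrad B i x) x =
       pd (axis i 1) (\<lambda>x. trace_hess B x * mgrad A i x) x + pd (axis i 1) (\<lambda>x. quad_grad A x * mgrad B i x) x"
      by (intro pd_add differentiable_mult differentiable_forms)
    finally show ?thesis
      by (simp add: pd_mult[OF differentiable_forms(6,4)] pd_mult[OF differentiable_forms(5,4)])
  qed
  have qA: "(\<Sum>i\<in>UNIV. pd (axis i 1) (mgrad A i) x) = trace_hess A x" for A
    by (simp add: pd_mgrad trace_hess_def)
  have pp: "(\<Sum>i\<in>UNIV. pd (axis i 1) (quad_grad A) x * mgrad B i x) = 2 * hess_form B A x"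
  proof -
    have "(\<Sum>i\<in>UNIV. pd (axis i 1) (quad_grad A) x * mgrad B i x) =
        2 * (\<Sum>i\<in>UNIV. \<Sum>k\<in>UNIV. mgrad B i x * (h i k x * mgrad A k x))"
      unfolding pd_quad_grad_axis[OF A]
      by (simp add: sum_distrib_left sum_distrib_right h_sym ac_simps)
    then show ?thesis by (simp add: hess_form_def)
  qed
  \<comment> \<open>The derivative of Tr(BH) along AY and the divergence falling on H in BHAY both
    give this sum, up to an exchange of the last two indices of \<open>h3\<close>.\<close>
  define X where "X = (\<Sum>i\<in>UNIV. \<Sum>k\<in>UNIV. \<Sum>l\<in>UNIV. B $ i $ k * (h3 k l i * mgrad A l x))"
  have qX: "(\<Sum>i\<in>UNIV. pd (axis i 1) (trace_hess B) x * mgrad A i x) = X"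
  proof -
    have "(\<Sum>i\<in>UNIV. pd (axis i 1) (trace_hess B) x * mgrad A i x) =
       (\<Sum>m\<in>UNIV. \<Sum>i\<in>UNIV. \<Sum>k\<in>UNIV. B $ i $ k * (h3 k i m * mgrad A m x))"
      by (simp add: pd_trace_hess sum_distrib_right h3_def mult.assoc)
    also have "\<dots> = (\<Sum>i\<in>UNIV. \<Sum>m\<in>UNIV. \<Sum>k\<in>UNIV. B $ i $ k * (h3 k i m * mgrad A m x))"
      by (rule sum.swap)
    also have "\<dots> = (\<Sum>i\<in>UNIV. \<Sum>k\<in>UNIV. \<Sum>m\<in>UNIV. B $ i $ k * (h3 k i m * mgrad A m x))"
      by (intro sum.cong refl sum.swap)
    also have "\<dots> = X"
      unfolding X_def by (intro sum.cong refl) (subst h3, rule refl)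
    finally show ?thesis .
  qed
  have cX: "(\<Sum>i\<in>UNIV. pd (axis i 1) (hess_mgrad A B i) x) = X + trace_hess_sq A B x"
    unfolding pd_hess_mgrad X_def trace_hess_sq_def h3_def
    by (simp add: sum_distrib_left distrib_left sum.distrib mult.assoc)
  have yZ: "(\<Sum>i\<in>UNIV. y i x * Z i x) = trace_hess B x * quad_grad A x + quad_grad A x * quad_grad B x - hess_form B A x"
  proof -
    \<comment> \<open>Symmetry of \<open>B\<close> lets it act on the outer factor Y instead of on
      HAY.\<close>
    have "(\<Sum>i\<in>UNIV. y i x * hess_mgrad A B i x) =
        (\<Sum>i\<in>UNIV. \<Sum>k\<in>UNIV. \<Sum>l\<in>UNIV. B $ k $ i * y i x * (h k l x * mgrad A l x))"
      unfolding hess_mgrad_def by (simp add: sum_distrib_left B'[of _ k for k] ac_simps)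
    also have "\<dots> = (\<Sum>k\<in>UNIV. \<Sum>i\<in>UNIV. \<Sum>l\<in>UNIV. B $ k $ i * y i x * (h k l x * mgrad A l x))"
      by (rule sum.swap)
    also have "\<dots> = hess_form B A x"
      unfolding hess_form_def mgrad_def[of B]
      by (simp add: sum_distrib_right sum_distrib_left) (intro sum.cong refl sum.swap)
    finally have "(\<Sum>i\<in>UNIV. y i x * hess_mgrad A B i x) = hess_form B A x" .
    then show ?thesis
      by (simp add: Z_def quad_grad_def algebra_simps sum.distrib sum_subtractf sum_distrib_left)
  qed
  have "(\<Sum>i\<in>UNIV. pd (axis i 1) (Z i) x) = trace_hess B x * trace_hess A x + X + (quad_grad A x * trace_hess B x + 2 * hess_form B A x) - (X + trace_hess_sq A B x)"
    unfolding Z sum.distrib sum_subtractf sum_distrib_left[symmetric] qA pp qX cX ..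
  then show ?thesis
    unfolding sum_subtractf yZ by (simp add: algebra_simps)
qed

text \<open>The weight absorbs the linear term: the gradient of exp(-\<psi>) is -Y exp(-\<psi>), so
  the integrand is the ordinary divergence of Z exp(-\<psi>). The separate \<open>F\<close> means
  that integrability is asked of the sum after cancellation.\<close>

lemma integral_\<nu>_divergence:
  assumes Z: "\<And>i. Ck (Suc 0) (Z i)" "\<And>i. integrable \<nu> (Z i)"
    and F: "\<And>x. (\<Sum>i\<in>UNIV. pd (axis i 1) (Z i) x - y i x * Z i x) = F x" "integrable \<nu> F"
  shows "(\<integral>x. F x \<partial>\<nu>) = 0"
proof -
  let ?W = "\<lambda>i x. Z i x * exp (- \<psi> x)"
  have dZ: "Z i differentiable (at x)" for i x
    using Ck_Suc_has_derivative[OF Z(1)] unfolding differentiable_def by blast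
  have dE: "(\<lambda>x. exp (- \<psi> x)) differentiable (at x)" for x
    using Ck_Suc_has_derivative[OF Ck_exp[OF Ck_uminus[OF smooth]]] unfolding differentiable_def by blast
  have "pd (axis i 1) (?W i) x = (pd (axis i 1) (Z i) x - y i x * Z i x) * exp (- \<psi> x)" for i x
    by (simp add: pd_mult[OF dZ dE] pd_exp_minus[OF differentiable_forms(3)] algebra_simps)
  then have div: "(\<Sum>i\<in>UNIV. pd (axis i 1) (?W i) x) = F x * exp (- \<psi> x)" for x
    by (simp add: F(1)[symmetric] sum_distrib_right)
  have mZ: "Z i \<in> borel_measurable borel" for i
    by (rule Ck_measurable[OF Z(1)])
  have mF: "F \<in> borel_measurable borel"
    using borel_measurable_integrable[OF F(2)] by simp
  have "(\<integral>x. (\<Sum>i\<in>UNIV. pd (axis i 1) (?W i) x) \<partial>lborel) = 0"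
  proof (rule integral_divergence_eq_0)
    show "Ck (Suc 0) (?W i)" for i
      by (intro Ck_intros Z smooth)
    show "integrable lborel (?W i)" for i
      using Z(2)[of i] by (simp add: integrable_\<nu>[OF mZ])
    show "integrable lborel (\<lambda>x. \<Sum>i\<in>UNIV. pd (axis i 1) (?W i) x)"
      using F(2) by (simp only: div integrable_\<nu>[OF mF])
  qed
  then show ?thesis
    by (simp only: div integral_\<nu>[OF mF])
qed

section \<open>Integral identities and the variance inequality under square-integrable Hessian
  entries\<close>

context
  assumes h2: "\<And>i j. square_integrable \<nu> (h i j)"
begin

lemma trace_hess_square_integrable: "square_integrable \<nu> (trace_hess A)"
  unfolding trace_hess_def[abs_def]
  by (intro square_integrable_sum square_integrable_ess_bounded_mult ess_bounded_const h2)

lemma h_mgrad_square_integrable: "square_integrable \<nu> (\<lambda>x. h k l x * mgrad A l x)"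
  using square_integrable_ess_bounded_mult[OF mgrad_bounded h2] by (simp add: mult.commute)

lemma hess_form_integrable: "integrable \<nu> (hess_form A B)"
  unfolding hess_form_def[abs_def]
  by (intro Bochner_Integration.integrable_sum integrable_ess_bounded_mult mgrad_bounded
      square_integrable_imp_integrable h_mgrad_square_integrable)

lemma trace_hess_sq_integrable: "integrable \<nu> (trace_hess_sq A B)"
proof -
  have "integrable \<nu> (\<lambda>x. B $ i $ k * (h k l x * (A $ l $ r * h r i x)))" for i k l r
    by (intro integrable_mult_right square_integrable_mult h2
        square_integrable_ess_bounded_mult ess_bounded_const)
  then show ?thesis
    unfolding trace_hess_sq_def[abs_def] by (intro Bochner_Integration.integrable_sum)
qed

lemma hess_mgrad_integrable: "integrable \<nu> (hess_mgrad A B i)"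
  unfolding hess_mgrad_def[abs_def]
  by (intro Bochner_Integration.integrable_sum integrable_mult_right
      square_integrable_imp_integrable h_mgrad_square_integrable)

text \<open>Integration by parts for the field AY. It equates the means of Tr(AH) and Y \<bullet>
  AY, so that an identity between the covariances reduces to one between second moments.\<close>

lemma integral_trace_hess: "(\<integral>x. trace_hess A x \<partial>\<nu>) = (\<integral>x. quad_grad A x \<partial>\<nu>)"
proof -
  have "(\<integral>x. trace_hess A x - quad_grad A x \<partial>\<nu>) = 0"
  proof (rule integral_\<nu>_divergence)
    show "Ck (Suc 0) (mgrad A i)" for i by (rule Ck_forms)
    show "integrable \<nu> (mgrad A i)" for i
      by (intro square_integrable_imp_integrable ess_bounded_imp_square_integrable mgrad_bounded)
    show "(\<Sum>i\<in>UNIV. pd (axis i 1) (mgrad A i) x - y i x * mgrad A i x) = trace_hess A x - quad_grad A x" for x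
      by (simp add: sum_subtractf pd_mgrad trace_hess_def quad_grad_def)
    show "integrable \<nu> (\<lambda>x. trace_hess A x - quad_grad A x)"
      by (intro Bochner_Integration.integrable_diff square_integrable_imp_integrable
          ess_bounded_imp_square_integrable trace_hess_square_integrable quad_grad_bounded)
  qed
  moreover have "(\<integral>x. trace_hess A x - quad_grad A x \<partial>\<nu>) = (\<integral>x. trace_hess A x \<partial>\<nu>) - (\<integral>x. quad_grad A x \<partial>\<nu>)"
    by (intro Bochner_Integration.integral_diff square_integrable_imp_integrable
          ess_bounded_imp_square_integrable trace_hess_square_integrable quad_grad_bounded)
  ultimately show ?thesis by simp
qed

lemma quad_grad_mult_integrable: "integrable \<nu> (\<lambda>x. quad_grad A x * quad_grad B x)"
  by (intro square_integrable_mult ess_bounded_imp_square_integrable quad_grad_bounded)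

lemma trace_hess_mult_integrable: "integrable \<nu> (\<lambda>x. trace_hess A x * trace_hess B x)"
  by (intro square_integrable_mult trace_hess_square_integrable)

text \<open>The field has at most one Hessian factor in each summand and its weighted divergence at
  most two; all other factors are bounded, so square integrability of the entries is enough.\<close>

lemma integral_trace_hess_mult:
  assumes A: "transpose A = A" and B: "transpose B = B"
  shows "(\<integral>x. trace_hess A x * trace_hess B x \<partial>\<nu>) =
    (\<integral>x. quad_grad A x * quad_grad B x \<partial>\<nu>) - 3 * (\<integral>x. hess_form B A x \<partial>\<nu>) + (\<integral>x. trace_hess_sq A B x \<partial>\<nu>)"
proof -
  have "(\<integral>x. trace_hess A x * trace_hess B x + 3 * hess_form B A x - quad_grad A x * quad_grad B x - trace_hess_sq A B x \<partial>\<nu>) = 0"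
  proof (rule integral_\<nu>_divergence)
    let ?Z = "\<lambda>i x. trace_hess B x * mgrad A i x + quad_grad A x * mgrad B i x - hess_mgrad A B i x"
    show "Ck (Suc 0) (?Z i)" for i
      by (intro Ck_intros Ck_forms)
    have "integrable \<nu> (\<lambda>x. mgrad A i x * trace_hess B x)" for i
      by (intro integrable_ess_bounded_mult mgrad_bounded square_integrable_imp_integrable trace_hess_square_integrable)
    then have "integrable \<nu> (\<lambda>x. trace_hess B x * mgrad A i x)" for i
      by (simp add: mult.commute)
    moreover have "integrable \<nu> (\<lambda>x. quad_grad A x * mgrad B i x)" for i
      by (intro square_integrable_imp_integrable ess_bounded_imp_square_integrable ess_bounded_mult
          mgrad_bounded quad_grad_bounded)
    ultimately show "integrable \<nu> (?Z i)" for i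
      by (intro Bochner_Integration.integrable_diff Bochner_Integration.integrable_add hess_mgrad_integrable)
    show "(\<Sum>i\<in>UNIV. pd (axis i 1) (?Z i) x - y i x * ?Z i x) =
       trace_hess A x * trace_hess B x + 3 * hess_form B A x - quad_grad A x * quad_grad B x - trace_hess_sq A B x" for x
      by (rule divergence_identity[OF A B])
    show "integrable \<nu> (\<lambda>x. trace_hess A x * trace_hess B x + 3 * hess_form B A x - quad_grad A x * quad_grad B x - trace_hess_sq A B x)"
      by (intro Bochner_Integration.integrable_diff Bochner_Integration.integrable_add
          integrable_mult_right trace_hess_mult_integrable quad_grad_mult_integrable hess_form_integrable trace_hess_sq_integrable)
  qed
  then show ?thesis
    by (simp add: trace_hess_mult_integrable quad_grad_mult_integrable hess_form_integrable trace_hess_sq_integrable)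
qed

lemma variance_quad_grad_le:
  assumes A: "transpose A = A"
  shows "(\<integral>x. quad_grad A x * quad_grad A x \<partial>\<nu>) - (\<integral>x. quad_grad A x \<partial>\<nu>)\<^sup>2 \<le> 4 * (\<integral>x. hess_form A A x \<partial>\<nu>)"
proof -
  \<comment> \<open>The dual energy of the gradient 2HAY: formally the inverse Hessian cancels one
    of the two factors H.\<close>
  let ?Q = "\<lambda>x. 4 * hess_form A A x"
  have int: "integrable \<nu> (\<lambda>x. (quad_grad A x)\<^sup>2 - ?Q x)"
    using quad_grad_mult_integrable[of A A] hess_form_integrable[of A A] by (simp add: power2_eq_square)
  have p: "integrable \<nu> (quad_grad A)"
    by (intro square_integrable_imp_integrable ess_bounded_imp_square_integrable quad_grad_bounded)
  have "(\<integral>x. exp (- \<psi> x) \<partial>lborel) * (\<integral>x. ((quad_grad A x)\<^sup>2 - ?Q x) * exp (- \<psi> x) \<partial>lborel)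
           \<le> (\<integral>x. quad_grad A x * exp (- \<psi> x) \<partial>lborel)\<^sup>2"
  proof (rule brascamp_lieb)
    show "Ck 2 \<psi>" "Ck 1 (quad_grad A)" "Ck 0 ?Q"
      by (rule smooth, rule Ck_forms, intro Ck_intros Ck_forms)
    show "integrable lborel (\<lambda>x. exp (- \<psi> x))"
      by (rule exp_integrable)
    show "integrable lborel (\<lambda>x. quad_grad A x * exp (- \<psi> x))"
      using p by (simp add: integrable_\<nu>)
    show "integrable lborel (\<lambda>x. ((quad_grad A x)\<^sup>2 - ?Q x) * exp (- \<psi> x))"
      using int by (simp add: integrable_\<nu>)
    fix x w
    let ?H = "hessian \<psi> x" and ?c = "A *v grad \<psi> x"
    have sym: "(?H *v ?c) \<bullet> w = (?H *v w) \<bullet> ?c"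
      using dot_lmul_matrix[of w ?H ?c] hessian_Sym[of x] transpose_matrix_vector[of ?H w]
      by (simp add: inner_commute)
    \<comment> \<open>Completing the square: as a polynomial in \<open>w\<close>, the required
      expression is the Hessian form at w + 2AY.\<close>
    have "0 \<le> (?H *v (w + 2 *\<^sub>R ?c)) \<bullet> (w + 2 *\<^sub>R ?c)"
      by (rule hessian_nonneg)
    also have "\<dots> = ?Q x + 2 * pd w (quad_grad A) x + pd w (pd w \<psi>) x"
      unfolding pd_quad_grad[OF A] pd_pd_eq hess_form_eq matrix_vector_right_distrib matrix_vector_mult_scaleR
      using sym by (simp add: inner_add_left inner_add_right inner_commute[of ?c])
    finally show "0 \<le> ?Q x + 2 * pd w (quad_grad A) x + pd w (pd w \<psi>) x" .
  qed
  then have "(\<integral>x. (quad_grad A x)\<^sup>2 - ?Q x \<partial>\<nu>) \<le> (\<integral>x. quad_grad A x \<partial>\<nu>)\<^sup>2"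
    by (simp add: total integral_\<nu>)
  then show ?thesis
    using quad_grad_mult_integrable[of A A] hess_form_integrable[of A A] by (simp add: power2_eq_square)
qed

end

end

section \<open>The covariance forms of a moment potential\<close>

lemma (in prob_space) covariance_eq:
  assumes "integrable M X" "integrable M Z" "integrable M (\<lambda>x. X x * Z x)"
  shows "covariance M X Z = expectation (\<lambda>x. X x * Z x) - expectation X * expectation Z"
proof -
  have "covariance M X Z = (\<integral>x. X x * Z x - expectation X * Z x - expectation Z * X x
      + expectation X * expectation Z \<partial>M)"
    unfolding covariance_def by (intro Bochner_Integration.integral_cong) (auto simp: algebra_simps)
  also have "\<dots> = expectation (\<lambda>x. X x * Z x) - expectation X * expectation Z"
    using assms by (simp add: prob_space)
  finally show ?thesis .
qed

context bounded_gradient_potential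
begin

lemma grad_continuous: "continuous_on A (grad \<psi>)"
  using grad_has_derivative
  by (auto intro!: continuous_at_imp_continuous_on has_derivative_continuous)

lemma grad_measurable [measurable]: "grad \<psi> \<in> borel_measurable borel"
  by (intro borel_measurable_continuous_onI grad_continuous)

lemma hessian_measurable: "hessian \<psi> \<in> borel_measurable borel"
proof (rule borel_measurable_continuous_onI)
  have "hessian \<psi> = (\<lambda>x. \<chi> i j. h i j x)"
    by (auto simp: vec_eq_iff hessian_nth)
  moreover have "continuous_on UNIV (\<lambda>x. \<chi> i j. h i j x)"
    by (intro continuous_on_vec_lambda Ck_continuous[OF Ck_pd(2)])
  ultimately show "continuous_on UNIV (hessian \<psi>)" by simp
qed

text \<open>By symmetry of the Hessian, the energy at the identity matrix is the sum of the squares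
  of all entries, and so dominates each of them.\<close>

lemma square_integrable_h:
  assumes "integrable \<nu> (\<lambda>x. trace (mat 1 ** hessian \<psi> x ** mat 1 ** hessian \<psi> x))"
  shows "square_integrable \<nu> (h i j)"
proof -
  have eq: "trace (mat 1 ** hessian \<psi> x ** mat 1 ** hessian \<psi> x) = (\<Sum>i\<in>UNIV. \<Sum>j\<in>UNIV. (h i j x)\<^sup>2)" for x
    using h_sym by (simp add: trace_def matrix_matrix_mult_def[of "hessian \<psi> x"] hessian_nth power2_eq_square)
  have "integrable \<nu> (\<lambda>x. (h i j x)\<^sup>2)"
  proof (rule Bochner_Integration.integrable_bound[OF assms])
    show "AE x in \<nu>. norm ((h i j x)\<^sup>2) \<le> norm (trace (mat 1 ** hessian \<psi> x ** mat 1 ** hessian \<psi> x))"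
    proof (intro AE_I2)
      fix x
      have "(h i j x)\<^sup>2 \<le> (\<Sum>j\<in>UNIV. (h i j x)\<^sup>2)"
        by (rule member_le_sum) auto
      also have "\<dots> \<le> (\<Sum>i\<in>UNIV. \<Sum>j\<in>UNIV. (h i j x)\<^sup>2)"
        by (rule member_le_sum[of i UNIV "\<lambda>i. \<Sum>j\<in>UNIV. (h i j x)\<^sup>2"]) (auto intro: sum_nonneg)
      finally show "norm ((h i j x)\<^sup>2) \<le> norm (trace (mat 1 ** hessian \<psi> x ** mat 1 ** hessian \<psi> x))"
        unfolding eq by simp
    qed
  qed measurable
  then show ?thesis by (simp add: square_integrable_def)
qed

section \<open>Transfer from the law of \<open>U\<close> to an arbitrary probability space\<close>

context
  fixes P :: "'w measure" and U :: "'w \<Rightarrow> real^'n"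
  assumes P: "prob_space P"
    and U: "distributed P lborel U (\<lambda>u. ennreal (exp (- \<psi> u)))"
begin

lemma U_measurable: "U \<in> measurable P borel"
  using distributed_measurable[OF U] by simp

lemma distr_U: "distr P borel U = \<nu>"
  using distributed_distr_eq_density[OF U] by (simp add: moment_law_def cong: distr_cong)

lemma integral_U: "f \<in> borel_measurable borel \<Longrightarrow> (\<integral>\<omega>. f (U \<omega>) \<partial>P) = (\<integral>x. f x \<partial>\<nu>)" for f :: "_ \<Rightarrow> real"
  unfolding distr_U[symmetric] by (simp add: integral_distr U_measurable)

lemma integrable_U: "f \<in> borel_measurable borel \<Longrightarrow> integrable P (\<lambda>\<omega>. f (U \<omega>)) \<longleftrightarrow> integrable \<nu> f" for f :: "_ \<Rightarrow> real"
  unfolding distr_U[symmetric] by (simp add: integrable_distr_eq U_measurable)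

abbreviation Y :: "'w \<Rightarrow> real^'n" where "Y \<equiv> \<lambda>\<omega>. grad \<psi> (U \<omega>)"

abbreviation H :: "'w \<Rightarrow> real^'n^'n" where "H \<equiv> \<lambda>\<omega>. hessian \<psi> (U \<omega>)"

lemma energy_boundD:
  assumes "energy_bound P H C"
  shows "square_integrable \<nu> (h i j)"
proof -
  have "integrable P (\<lambda>\<omega>. trace (mat 1 ** H \<omega> ** mat 1 ** H \<omega>))"
    \<comment> \<open>The identity factors are protected from simplification so that the integrand
      still has the shape of \<open>trace_hess_sq_eq\<close>.\<close>
    using assms by (simp add: energy_bound_def Sym_def del: matrix_mul_lid matrix_mul_rid)
  then have "integrable P (\<lambda>\<omega>. trace_hess_sq (mat 1) (mat 1) (U \<omega>))"
    by (simp only: trace_hess_sq_eq)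
  then have "integrable \<nu> (trace_hess_sq (mat 1) (mat 1))"
    by (simp add: integrable_U)
  then show ?thesis
    by (intro square_integrable_h) (simp only: trace_hess_sq_eq[symmetric])
qed

context
  assumes h2: "\<And>i j. square_integrable \<nu> (h i j)"
begin

text \<open>The means are expressed through \<open>quad_grad\<close>, so that their product is
  literally the one in \<open>Gamma_quad_eq\<close> and cancels in
  \<open>Gamma_tr_identity\<close>.\<close>

lemma Gamma_tr_eq: "Gamma_tr P H A B = (\<integral>x. trace_hess A x * trace_hess B x \<partial>\<nu>) - (\<integral>x. quad_grad A x \<partial>\<nu>) * (\<integral>x. quad_grad B x \<partial>\<nu>)"
proof -
  have "integrable P (\<lambda>\<omega>. trace_hess A (U \<omega>))" for A
    using square_integrable_imp_integrable[OF trace_hess_square_integrable[OF h2]] by (simp add: integrable_U)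
  moreover have "integrable P (\<lambda>\<omega>. trace_hess A (U \<omega>) * trace_hess B (U \<omega>))"
    using trace_hess_mult_integrable[OF h2, of A B] integrable_U[of "\<lambda>x. trace_hess A x * trace_hess B x"] by simp
  ultimately have "Gamma_tr P H A B = (\<integral>\<omega>. trace_hess A (U \<omega>) * trace_hess B (U \<omega>) \<partial>P) - (\<integral>\<omega>. trace_hess A (U \<omega>) \<partial>P) * (\<integral>\<omega>. trace_hess B (U \<omega>) \<partial>P)"
    unfolding Gamma_tr_def trace_hess_eq[symmetric] by (intro prob_space.covariance_eq[OF P])
  then show ?thesis
    using integral_U[of "\<lambda>x. trace_hess A x * trace_hess B x"] integral_U[of "trace_hess A"] integral_U[of "trace_hess B"]
    by (simp add: integral_trace_hess[OF h2])
qed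

lemma Gamma_quad_eq: "Gamma_quad P Y A B = (\<integral>x. quad_grad A x * quad_grad B x \<partial>\<nu>) - (\<integral>x. quad_grad A x \<partial>\<nu>) * (\<integral>x. quad_grad B x \<partial>\<nu>)"
proof -
  have "integrable P (\<lambda>\<omega>. quad_grad A (U \<omega>))" for A
    using square_integrable_imp_integrable[OF ess_bounded_imp_square_integrable[OF quad_grad_bounded]]
    by (simp add: integrable_U)
  moreover have "integrable P (\<lambda>\<omega>. quad_grad A (U \<omega>) * quad_grad B (U \<omega>))"
    using quad_grad_mult_integrable[OF h2, of A B] integrable_U[of "\<lambda>x. quad_grad A x * quad_grad B x"] by simp
  ultimately have "Gamma_quad P Y A B = (\<integral>\<omega>. quad_grad A (U \<omega>) * quad_grad B (U \<omega>) \<partial>P) - (\<integral>\<omega>. quad_grad A (U \<omega>) \<partial>P) * (\<integral>\<omega>. quad_grad B (U \<omega>) \<partial>P)"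
    unfolding Gamma_quad_def quad_grad_eq[symmetric] by (intro prob_space.covariance_eq[OF P])
  then show ?thesis
    using integral_U[of "\<lambda>x. quad_grad A x * quad_grad B x"] integral_U[of "quad_grad A"] integral_U[of "quad_grad B"] by simp
qed

lemma T_form_eq: "T_form P Y H A B = (\<integral>x. hess_form A B x \<partial>\<nu>)"
  unfolding T_form_def hess_form_eq[symmetric] by (simp add: integral_U)

lemma U_form_eq: "U_form P H A B = (\<integral>x. trace_hess_sq B A x \<partial>\<nu>)"
  unfolding U_form_def trace_hess_sq_eq[symmetric] by (simp add: integral_U)

lemma forms_are_well_defined: "forms_well_defined P Y H"
proof -
  have "integrable P (\<lambda>\<omega>. trace_hess A (U \<omega>) * trace_hess A (U \<omega>))" "integrable P (\<lambda>\<omega>. quad_grad A (U \<omega>) * quad_grad A (U \<omega>))"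
    "integrable P (\<lambda>\<omega>. hess_form A B (U \<omega>))" "integrable P (\<lambda>\<omega>. trace_hess_sq B A (U \<omega>))" for A B
    using trace_hess_mult_integrable[OF h2, of A A] integrable_U[of "\<lambda>x. trace_hess A x * trace_hess A x"]
      quad_grad_mult_integrable[OF h2, of A A] integrable_U[of "\<lambda>x. quad_grad A x * quad_grad A x"]
      hess_form_integrable[OF h2, of A B] trace_hess_sq_integrable[OF h2, of B A] by (simp_all add: integrable_U)
  moreover have "Y \<in> borel_measurable P" "H \<in> borel_measurable P"
    by (rule measurable_compose[OF U_measurable grad_measurable]
        measurable_compose[OF U_measurable hessian_measurable])+
  ultimately show ?thesis
    unfolding forms_well_defined_def trace_hess_sq_eq[symmetric]
    unfolding trace_hess_eq[symmetric] quad_grad_eq[symmetric] hess_form_eq[symmetric] power2_eq_square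
    by simp
qed

lemma Gamma_tr_identity:
  assumes "A \<in> Sym" "B \<in> Sym"
  shows "Gamma_tr P H A B = Gamma_quad P Y A B + U_form P H A B - 3 * T_form P Y H A B"
  \<comment> \<open>The arguments are exchanged because \<open>hess_form\<close> and
    \<open>trace_hess_sq\<close> then appear in the order used by \<open>T_form_eq\<close> and
    \<open>U_form_eq\<close>.\<close>
  using integral_trace_hess_mult[OF h2, of B A] assms
  by (simp add: Gamma_tr_eq Gamma_quad_eq T_form_eq U_form_eq Sym_def mult.commute)

lemma D_form_nonneg:
  assumes "A \<in> Sym"
  shows "0 \<le> D_form P Y H A A"
  using variance_quad_grad_le[OF h2, of A] assms
  by (simp add: D_form_def Gamma_quad_eq T_form_eq Sym_def power2_eq_square)

end

lemma variance_forms: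
  "prob_space.variance P (\<lambda>\<omega>. trace (A ** H \<omega>)) = Gamma_tr P H A A"
  "prob_space.variance P (\<lambda>\<omega>. Y \<omega> \<bullet> (A *v Y \<omega>)) = Gamma_quad P Y A A"
  by (simp_all add: Gamma_tr_def Gamma_quad_def covariance_def power2_eq_square)

lemma Gamma_tr_nonneg: "0 \<le> Gamma_tr P H A A"
  by (simp add: Gamma_tr_def covariance_def)

lemma forms_comparison:
  assumes quad: "quadratic_variance_bound P Y Cq" and en: "energy_bound P H Cen"
  shows "forms_well_defined P Y H"
    and "(\<lambda>A B. 0) \<preceq>\<^sub>S Gamma_tr P H"
    and "Gamma_tr P H \<preceq>\<^sub>S (\<lambda>A B. (Cq / 4 + Cen) * I_form A B)"
    and "\<forall>A\<in>Sym. \<forall>B\<in>Sym. (Cq / 4 + Cen) * I_form A B - Gamma_tr P H A B =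
               1 / 4 * (Cq * I_form A B - Gamma_quad P Y A B)
               + (Cen * I_form A B - U_form P H A B)
               + 3 / 4 * D_form P Y H A B"
    and "(\<lambda>A B. 0) \<preceq>\<^sub>S (\<lambda>A B. 1 / 4 * (Cq * I_form A B - Gamma_quad P Y A B))"
    and "(\<lambda>A B. 0) \<preceq>\<^sub>S (\<lambda>A B. Cen * I_form A B - U_form P H A B)"
    and "(\<lambda>A B. 0) \<preceq>\<^sub>S (\<lambda>A B. 3 / 4 * D_form P Y H A B)"
proof -
  note h2 = energy_boundD[OF en]
  show "forms_well_defined P Y H"
    by (rule forms_are_well_defined[OF h2])
  show "(\<lambda>A B. 0) \<preceq>\<^sub>S Gamma_tr P H"
    using Gamma_tr_nonneg by (simp add: form_le_def)
  \<comment> \<open>Inserting 4T = D + \<open>Gamma_quad\<close> into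
    \<open>Gamma_tr_identity\<close> turns \<open>Gamma_quad\<close> - 3T into
    \<open>Gamma_quad\<close>/4 - (3/4) D; this is the origin of the coefficients 1/4 and
    3/4.\<close>
  show id: "\<forall>A\<in>Sym. \<forall>B\<in>Sym. (Cq / 4 + Cen) * I_form A B - Gamma_tr P H A B =
               1 / 4 * (Cq * I_form A B - Gamma_quad P Y A B)
               + (Cen * I_form A B - U_form P H A B)
               + 3 / 4 * D_form P Y H A B"
    by (simp add: Gamma_tr_identity[OF h2] D_form_def algebra_simps)
  show q: "(\<lambda>A B. 0) \<preceq>\<^sub>S (\<lambda>A B. 1 / 4 * (Cq * I_form A B - Gamma_quad P Y A B))"
    using quad unfolding quadratic_variance_bound_def variance_forms by (simp add: form_le_def I_form_def)
  show e: "(\<lambda>A B. 0) \<preceq>\<^sub>S (\<lambda>A B. Cen * I_form A B - U_form P H A B)"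
    using en by (simp add: energy_bound_def form_le_def I_form_def U_form_def)
  show d: "(\<lambda>A B. 0) \<preceq>\<^sub>S (\<lambda>A B. 3 / 4 * D_form P Y H A B)"
    by (simp add: form_le_def D_form_nonneg[OF h2])
  show "Gamma_tr P H \<preceq>\<^sub>S (\<lambda>A B. (Cq / 4 + Cen) * I_form A B)"
    unfolding form_le_def
  proof
    fix A :: "real^'n^'n" assume "A \<in> Sym"
    then show "0 \<le> (Cq / 4 + Cen) * I_form A A - Gamma_tr P H A A"
      using id q e d by (simp add: form_le_def)
  qed
qed

lemma variance_bounds:
  assumes quad: "quadratic_variance_bound P Y 8" and en: "energy_bound P H 2"
  shows "\<forall>A\<in>Sym. prob_space.variance P (\<lambda>\<omega>. trace (A ** H \<omega>)) \<le> 4 * trace (A ** A)"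
    and "prob_space.variance P (\<lambda>\<omega>. trace (H \<omega>)) \<le> 4 * real CARD('n)"
proof -
  \<comment> \<open>The constant is 8 / 4 + 2.\<close>
  show *: "\<forall>A\<in>Sym. prob_space.variance P (\<lambda>\<omega>. trace (A ** H \<omega>)) \<le> 4 * trace (A ** A)"
    using forms_comparison(3)[OF quad en] unfolding variance_forms by (simp add: form_le_def I_form_def)
  have "mat 1 \<in> (Sym :: (real^'n^'n) set)"
    by (simp add: Sym_def)
  from bspec[OF * this] show "prob_space.variance P (\<lambda>\<omega>. trace (H \<omega>)) \<le> 4 * real CARD('n)"
    by (simp add: trace_I)
qed

end

end

section \<open>Regular targets, their potentials and the final estimates\<close>

lemma regular_target_density_measurable:
  fixes V :: "real^'n \<Rightarrow> real"
  assumes "open K" "K \<subseteq> N" "smooth_on N V"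
  shows "(\<lambda>x. exp (- V x) * indicator K x) \<in> borel_measurable borel"
proof -
  have "Ck_on 0 V N"
    using assms(3) unfolding smooth_on_def by blast
  then have "continuous_on K V"
    using assms(2) by (auto intro: continuous_on_subset)
  then have "(\<lambda>x. indicator K x *\<^sub>R exp (- V x)) \<in> borel_measurable borel"
    using assms by (intro borel_measurable_continuous_on_indicator continuous_intros) auto
  then show ?thesis by (simp add: mult.commute)
qed

text \<open>Restricting \<open>V\<close> from the neighbourhood to \<open>K\<close> keeps it convex,
  and the density is Borel because \<open>K\<close> is open and \<open>V\<close> continuous there.
  This makes the variance hypothesis on log-concave vectors applicable to the target itself.\<close>

lemma regular_target_log_concave:
  assumes "regular_isotropic_log_concave_target \<mu>"
  shows "log_concave \<mu>"
proof -
  obtain K V N where *: "open K" "convex K" "closure K \<subseteq> N" "smooth_on N V" "convex_on N V"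
      "\<mu> = density lborel (\<lambda>y. ennreal (exp (- V y) * indicator K y))" and "prob_space \<mu>"
    using assms unfolding regular_isotropic_log_concave_target_def by blast
  have "K \<subseteq> N" using *(3) closure_subset by blast
  then have "convex_on K V"
    using *(2,5) by (blast intro: convex_on_subset)
  with * \<open>prob_space \<mu>\<close> regular_target_density_measurable[OF *(1) \<open>K \<subseteq> N\<close> *(4)]
  show ?thesis
    unfolding log_concave_def by blast
qed

text \<open>The density of \<open>\<mu>\<close> vanishes off the bounded set \<open>K\<close>, so
  the norm is bounded \<open>\<mu>\<close>-almost everywhere; pulled back along
  \<open>grad \<psi>\<close>, whose law is \<open>\<mu>\<close>, this bounds the gradient.\<close>

lemma bounded_gradient_potential_moment_potential:
  assumes target: "regular_isotropic_log_concave_target \<mu>" and pot: "moment_potential \<mu> \<psi>"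
  shows "bounded_gradient_potential \<psi>"
proof
  show smooth: "Ck k \<psi>" for k
    using pot by (simp add: moment_potential_def smooth_on_def)
  show "convex_on UNIV \<psi>"
  proof (rule convex_onI)
    fix t :: real and x z assume "0 < t" "t < 1"
    then show "\<psi> ((1 - t) *\<^sub>R x + t *\<^sub>R z) \<le> (1 - t) * \<psi> x + t * \<psi> z"
      \<comment> \<open>Strict convexity speaks of distinct points only; for equal points both sides
        agree.\<close>
      using pot by (cases "x = z")
        (auto simp: moment_potential_def strictly_convex_def less_imp_le scaleR_left_distrib[symmetric] algebra_simps)
  qed simp
  show "(\<integral>u. exp (- \<psi> u) \<partial>lborel) = 1"
    using pot by (simp add: moment_potential_def)
  obtain K V N where K: "bounded K" "open K" "closure K \<subseteq> N" "smooth_on N V"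
      "\<mu> = density lborel (\<lambda>y. ennreal (exp (- V y) * indicator K y))"
    using target unfolding regular_isotropic_log_concave_target_def by blast
  obtain C where C: "\<And>y. y \<in> K \<Longrightarrow> norm y \<le> C"
    using \<open>bounded K\<close> by (auto simp: bounded_iff)
  have "K \<subseteq> N" using K(3) closure_subset by blast
  note [measurable] = regular_target_density_measurable[OF K(2) this K(4)]
  have "AE y in \<mu>. norm y \<le> C"
    unfolding K(5)
  proof (subst AE_density)
    show "AE y in lborel. 0 < ennreal (exp (- V y) * indicator K y) \<longrightarrow> norm y \<le> C"
      using C by (intro AE_I2) (auto split: split_indicator)
  qed measurable
  moreover have "grad \<psi> \<in> borel_measurable (moment_law \<psi>)"
  proof -
    have "(\<lambda>x. grad \<psi> x \<bullet> b) \<in> borel_measurable borel" if "b \<in> Basis" for b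
      using that Ck_measurable[OF Ck_Suc_pd[OF smooth]]
      by (auto simp: Basis_vec_def inner_axis grad_def)
    then have "grad \<psi> \<in> borel_measurable borel"
      by (simp add: borel_measurable_euclidean_space[of "grad \<psi>"])
    then show ?thesis by (simp add: moment_law_def)
  qed
  ultimately show "\<exists>C. AE u in moment_law \<psi>. norm (grad \<psi> u) \<le> C"
    using pot by (auto simp: moment_potential_def AE_distr_iff dest!: sym[of _ \<mu>])
qed

theorem theorem3p3:
  fixes \<mu> :: "(real^'n) measure" and \<psi> :: "real^'n \<Rightarrow> real"
    and P :: "'w measure" and U :: "'w \<Rightarrow> real^'n"
    and Y :: "'w \<Rightarrow> real^'n" and H :: "'w \<Rightarrow> real^'n^'n"
  assumes target: "regular_isotropic_log_concave_target \<mu>"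
    and potential: "moment_potential \<mu> \<psi>"
    and P: "prob_space P"
    and U: "distributed P lborel U (\<lambda>u. ennreal (exp (- \<psi> u)))"
    and Y: "Y = (\<lambda>\<omega>. grad \<psi> (U \<omega>))"
    and H: "H = (\<lambda>\<omega>. hessian \<psi> (U \<omega>))"
  shows
    "(\<forall>Cq Cen :: real. 0 \<le> Cq \<longrightarrow> 0 \<le> Cen \<longrightarrow>
        quadratic_variance_bound P Y Cq \<longrightarrow> energy_bound P H Cen \<longrightarrow>
          forms_well_defined P Y H \<and>
          (\<lambda>A B. 0) \<preceq>\<^sub>S Gamma_tr P H \<and>
          Gamma_tr P H \<preceq>\<^sub>S (\<lambda>A B. (Cq / 4 + Cen) * I_form A B) \<and>
          (\<forall>A\<in>Sym. \<forall>B\<in>Sym.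
             (Cq / 4 + Cen) * I_form A B - Gamma_tr P H A B =
               1 / 4 * (Cq * I_form A B - Gamma_quad P Y A B)
               + (Cen * I_form A B - U_form P H A B)
               + 3 / 4 * D_form P Y H A B) \<and>
          (\<lambda>A B. 0) \<preceq>\<^sub>S (\<lambda>A B. 1 / 4 * (Cq * I_form A B - Gamma_quad P Y A B)) \<and>
          (\<lambda>A B. 0) \<preceq>\<^sub>S (\<lambda>A B. Cen * I_form A B - U_form P H A B) \<and>
          (\<lambda>A B. 0) \<preceq>\<^sub>S (\<lambda>A B. 3 / 4 * D_form P Y H A B))
     \<and>
     ((\<forall>M :: (real^'n) measure. log_concave M \<longrightarrow> isotropic M \<longrightarrow>
          quadratic_variance_bound M (\<lambda>w. w) 8) \<longrightarrow>
      (\<forall>(\<mu>' :: (real^'n) measure) \<psi>'.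
          regular_isotropic_log_concave_target \<mu>' \<longrightarrow> moment_potential \<mu>' \<psi>' \<longrightarrow>
          energy_bound (moment_law \<psi>') (hessian \<psi>') 2) \<longrightarrow>
        quadratic_variance_bound P Y 8 \<and> energy_bound P H 2 \<and>
        (\<forall>A\<in>Sym. \<forall>B\<in>Sym.
           4 * I_form A B - Gamma_tr P H A B =
             1 / 4 * (8 * I_form A B - Gamma_quad P Y A B)
             + (2 * I_form A B - U_form P H A B)
             + 3 / 4 * D_form P Y H A B) \<and>
        (\<lambda>A B. 0) \<preceq>\<^sub>S (\<lambda>A B. 4 * I_form A B - Gamma_tr P H A B) \<and>
        (\<forall>A\<in>Sym. prob_space.variance P (\<lambda>\<omega>. trace (A ** H \<omega>)) \<le> 4 * trace (A ** A)) \<and>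
        prob_space.variance P (\<lambda>\<omega>. trace (H \<omega>)) \<le> 4 * real CARD('n))"
proof -
  interpret bounded_gradient_potential \<psi>
    by (rule bounded_gradient_potential_moment_potential[OF target potential])
  note part1 = forms_comparison[OF P U, folded Y H]
  show ?thesis
  proof (intro conjI impI allI)
    fix Cq Cen :: real
    assume "quadratic_variance_bound P Y Cq" "energy_bound P H Cen"
    note part1[OF this]
    then show "forms_well_defined P Y H"
      "(\<lambda>A B. 0) \<preceq>\<^sub>S Gamma_tr P H"
      "Gamma_tr P H \<preceq>\<^sub>S (\<lambda>A B. (Cq / 4 + Cen) * I_form A B)"
      "\<forall>A\<in>Sym. \<forall>B\<in>Sym. (Cq / 4 + Cen) * I_form A B - Gamma_tr P H A B =
         1 / 4 * (Cq * I_form A B - Gamma_quad P Y A B) + (Cen * I_form A B - U_form P H A B)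
         + 3 / 4 * D_form P Y H A B"
      "(\<lambda>A B. 0) \<preceq>\<^sub>S (\<lambda>A B. 1 / 4 * (Cq * I_form A B - Gamma_quad P Y A B))"
      "(\<lambda>A B. 0) \<preceq>\<^sub>S (\<lambda>A B. Cen * I_form A B - U_form P H A B)"
      "(\<lambda>A B. 0) \<preceq>\<^sub>S (\<lambda>A B. 3 / 4 * D_form P Y H A B)"
      by this+
  next
    assume quad_hyp: "\<forall>M :: (real^'n) measure. log_concave M \<longrightarrow> isotropic M \<longrightarrow>
          quadratic_variance_bound M (\<lambda>w. w) 8"
      and energy_hyp: "\<forall>(\<mu>' :: (real^'n) measure) \<psi>'.
          regular_isotropic_log_concave_target \<mu>' \<longrightarrow> moment_potential \<mu>' \<psi>' \<longrightarrow>
          energy_bound (moment_law \<psi>') (hessian \<psi>') 2"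
    have "isotropic \<mu>"
      using target by (simp add: regular_isotropic_log_concave_target_def)
    then have bound: "quadratic_variance_bound \<mu> (\<lambda>w. w) 8"
      using quad_hyp regular_target_log_concave[OF target] by blast
    have \<mu>: "\<mu> = distr \<nu> borel (grad \<psi>)"
      using potential by (simp add: moment_potential_def)
    \<comment> \<open>The two assumed estimates concern the laws \<open>\<mu>\<close> and
      \<open>\<nu>\<close>, with identity and Hessian as random variables, while the goals concern
      \<open>Y\<close> and \<open>H\<close> on \<open>P\<close>. Two changes of variables, through
      \<open>U\<close> and through \<open>grad \<psi>\<close>, connect them.\<close>
    have law_Y: "(\<integral>\<omega>. g (Y \<omega>) \<partial>P) = (\<integral>w. g w \<partial>\<mu>)"
      if [measurable]: "g \<in> borel_measurable borel" for g :: "real^'n \<Rightarrow> real"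
    proof -
      have "(\<integral>\<omega>. g (Y \<omega>) \<partial>P) = (\<integral>x. g (grad \<psi> x) \<partial>\<nu>)"
        unfolding Y by (rule integral_U[OF P U]) measurable
      also have "\<dots> = (\<integral>w. g w \<partial>\<mu>)"
        unfolding \<mu> by (rule integral_distr[symmetric]) measurable
      finally show ?thesis .
    qed
    have [measurable]: "(\<lambda>w :: real^'n. w \<bullet> (A *v w)) \<in> borel_measurable borel" for A
      by (intro borel_measurable_continuous_onI continuous_intros)
    \<comment> \<open>A variance contains two nested integrals, hence two uses of
      \<open>law_Y\<close>: one for the mean and one for the centred square.\<close>
    have "prob_space.variance P (\<lambda>\<omega>. Y \<omega> \<bullet> (A *v Y \<omega>)) = prob_space.variance \<mu> (\<lambda>w. w \<bullet> (A *v w))" for A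
      using law_Y[of "\<lambda>w. w \<bullet> (A *v w)"]
        law_Y[of "\<lambda>w. (w \<bullet> (A *v w) - (\<integral>w. w \<bullet> (A *v w) \<partial>\<mu>))\<^sup>2"] by simp
    with bound show quad: "quadratic_variance_bound P Y 8"
      by (simp add: quadratic_variance_bound_def)
    have "energy_bound \<nu> (hessian \<psi>) 2"
      using energy_hyp target potential by blast
    then show en: "energy_bound P H 2"
      unfolding energy_bound_def H trace_hess_sq_eq[symmetric]
      by (simp add: integral_U[OF P U] integrable_U[OF P U])
    note part1 = part1[OF quad en]
    show "\<forall>A\<in>Sym. \<forall>B\<in>Sym. 4 * I_form A B - Gamma_tr P H A B =
        1 / 4 * (8 * I_form A B - Gamma_quad P Y A B) + (2 * I_form A B - U_form P H A B)
        + 3 / 4 * D_form P Y H A B"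
      using part1(4) by simp
    show "(\<lambda>A B. 0) \<preceq>\<^sub>S (\<lambda>A B. 4 * I_form A B - Gamma_tr P H A B)"
      using part1(3) by (simp add: form_le_def)
    show "\<forall>A\<in>Sym. prob_space.variance P (\<lambda>\<omega>. trace (A ** H \<omega>)) \<le> 4 * trace (A ** A)"
      "prob_space.variance P (\<lambda>\<omega>. trace (H \<omega>)) \<le> 4 * real CARD('n)"
      using variance_bounds[OF P U quad[unfolded Y] en[unfolded H]] unfolding H by this+
  qed
qed

end
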